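(* There exist absolute constants $c>0$, $c_0>0$ and $c_1>0$ such that the following holds. Let $\bm{M}_{\star}\in\mathbb{R}^{n_1\times n_2}$ have rank $r$, with ground-truth factors $\bm{X}_\star,\bm{Y}_\star$ and condition number $\kappa$ as defined in the context, and let $\bm{A}_1,\dots,\bm{A}_m\in\mathbb{R}^{n_1\times n_2}$ be sensing matrices with measurements $y_i=\langle \bm{A}_i,\bm{M}_\star\rangle$, $i=1,\dots,m$. Suppose the operator $\mathcal{A}$ satisfies the rank-$2r$ RIP with constant $\delta_{2r}\le c$. Let $\bm{Z}_0=\begin{bmatrix}\bm{X}_0\\ \bm{Y}_0\end{bmatrix}\in\mathbb{R}^{(n_1+n_2)\times r}$ be any initialization point satisfying \[ \min_{\bm{R}\in\mathcal{O}^{r\times r}}\|\bm{Z}_0\bm{R}-\bm{Z}_\star\|_{\mathrm{F}}\le c_0\,\frac{1}{\kappa^{3/2}}\,\sigma_{\min}^{1/2}. \] Run gradient descent with constant step size $\eta_t=\eta=c_1$: \[ \bm{X}_{t+1}=\bm{X}_t-\frac{\eta}{\|\bm{Y}_0\|^2}\sum_{i=1}^m\big(\langle\bm{A}_i,\bm{X}_t\bm{Y}_t^\top\rangle-y_i\big)\bm{A}_i\bm{Y}_t,\qquad \bm{Y}_{t+1}=\bm{Y}_t-\frac{\eta}{\|\bm{X}_0\|^2}\sum_{i=1}^m\big(\langle\bm{A}_i,\bm{X}_t\bm{Y}_t^\top\rangle-y_i\big)\bm{A}_i^\top\bm{X}_t, \] and let $\bm{Z}_t=\begin{bmatrix}\bm{X}_t\\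 \bm{Y}_t\end{bmatrix}$. Then for all $t\ge 0$, \[ \mathrm{dist}(\bm{Z}_t,\bm{Z}_\star)\le\Big(1-\frac{\eta}{50\kappa}\Big)^t\,\mathrm{dist}(\bm{Z}_0,\bm{Z}_\star). \]
   Context: $\bm{M}_\star\in\mathbb{R}^{n_1\times n_2}$ has rank $r$ and compact SVD $\bm{M}_\star=\bm{U}_\star\bm{\Sigma}_\star\bm{V}_\star^\top$; the ground-truth factors are $\bm{X}_\star=\bm{U}_\star\bm{\Sigma}_\star^{1/2}\in\mathbb{R}^{n_1\times r}$, $\bm{Y}_\star=\bm{V}_\star\bm{\Sigma}_\star^{1/2}\in\mathbb{R}^{n_2\times r}$, and $\bm{Z}_\star=\begin{bmatrix}\bm{X}_\star\\ \bm{Y}_\star\end{bmatrix}$. $\sigma_{\max}=\sigma_1(\bm{M}_\star)$, $\sigma_{\min}=\sigma_r(\bm{M}_\star)$, $\kappa=\sigma_{\max}/\sigma_{\min}$. $\mathcal{A}:\mathbb{R}^{n_1\times n_2}\to\mathbb{R}^m$ is $\mathcal{A}(\bm{M})=(\langle\bm{A}_i,\bm{M}\rangle)_{1\le i\le m}$, with $\langle\bm{X},\bm{Y}\rangle=\mathrm{Tr}(\bm{Y}^\top\bm{X})$. $\mathcal{A}$ satisfies the rank-$k$ RIP with constant $\delta_k\in[0,1)$ if $(1-\delta_k)\|\bm{M}\|_{\mathrm{F}}^2\le\|\mathcal{A}(\bm{M})\|_2^2\le(1+\delta_k)\|\bm{M}\|_{\mathrm{F}}^2$ for all $\bm{M}$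 of rank at most $k$. $\mathcal{O}^{r\times r}$ is the set of $r\times r$ orthogonal matrices; $\|\cdot\|$ is the spectral norm. For $\bm{Z}=\begin{bmatrix}\bm{X}\\ \bm{Y}\end{bmatrix}$ with $\bm{X}\in\mathbb{R}^{n_1\times r},\bm{Y}\in\mathbb{R}^{n_2\times r}$, \[ \mathrm{dist}(\bm{Z},\bm{Z}_\star)=\inf_{\bm{P}\in\mathbb{R}^{r\times r}\text{ invertible}}\sqrt{\|\bm{X}\bm{P}-\bm{X}_\star\|_{\mathrm{F}}^2+\|\bm{Y}\bm{P}^{-\top}-\bm{Y}_\star\|_{\mathrm{F}}^2}, \] where $\bm{P}^{-\top}=(\bm{P}^{-1})^\top$. *)

theory Defs
  imports "Jordan_Normal_Form.DL_Rank"
begin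

definition frob_norm :: "real mat \<Rightarrow> real" where
  "frob_norm A = sqrt (\<Sum>i<dim_row A. \<Sum>j<dim_col A. (A $$ (i,j))^2)"

definition vec_norm2 :: "real vec \<Rightarrow> real" where
  "vec_norm2 v = sqrt (\<Sum>i<dim_vec v. (v $ i)^2)"

definition spec_norm :: "real mat \<Rightarrow> real" where
  "spec_norm A = Sup {vec_norm2 (A *\<^sub>v v) | v. v \<in> carrier_vec (dim_col A) \<and> vec_norm2 v = 1}"

definition mat_inner :: "real mat \<Rightarrow> real mat \<Rightarrow> real" where
  "mat_inner X Y = (let B = transpose_mat Y * X in \<Sum>i<dim_row B. B $$ (i,i))"

definition mat_rank :: "nat \<Rightarrow> real mat \<Rightarrow> nat" where
  "mat_rank n A = vec_space.rank n (A :: real mat)"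

definition RIP :: "(nat \<Rightarrow> real mat) \<Rightarrow> nat \<Rightarrow> nat \<Rightarrow> nat \<Rightarrow> nat \<Rightarrow> real \<Rightarrow> bool" where
  "RIP A m n1 n2 k \<delta> \<longleftrightarrow> 0 \<le> \<delta> \<and> \<delta> < 1 \<and>
     (\<forall>M \<in> carrier_mat n1 n2. mat_rank n1 M \<le> k \<longrightarrow>
        (1 - \<delta>) * (frob_norm M)^2 \<le> (\<Sum>i<m. (mat_inner (A i) M)^2) \<and>
        (\<Sum>i<m. (mat_inner (A i) M)^2) \<le> (1 + \<delta>) * (frob_norm M)^2)"

definition compact_svd :: "real mat \<Rightarrow> nat \<Rightarrow> nat \<Rightarrow> nat \<Rightarrow> real mat \<Rightarrow> (nat \<Rightarrow> real) \<Rightarrow> real mat \<Rightarrow> bool" where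
  "compact_svd M n1 n2 r U s V \<longleftrightarrow>
     U \<in> carrier_mat n1 r \<and> V \<in> carrier_mat n2 r \<and>
     transpose_mat U * U = 1\<^sub>m r \<and> transpose_mat V * V = 1\<^sub>m r \<and>
     (\<forall>i<r. 0 < s i) \<and> (\<forall>i j. i \<le> j \<and> j < r \<longrightarrow> s j \<le> s i) \<and>
     M = U * mat_diag r s * transpose_mat V"

definition orth_mats :: "nat \<Rightarrow> real mat set" where
  "orth_mats r = {R \<in> carrier_mat r r. transpose_mat R * R = 1\<^sub>m r}"

definition fac_dist :: "nat \<Rightarrow> real mat \<Rightarrow> real mat \<Rightarrow> real mat \<Rightarrow> real mat \<Rightarrow> real" where
  "fac_dist r X Y Xs Ys = Inf {sqrt ((frob_norm (X * P - Xs))^2 + (frob_norm (Y * transpose_mat Q - Ys))^2)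
      | P Q. P \<in> carrier_mat r r \<and> Q \<in> carrier_mat r r \<and> P * Q = 1\<^sub>m r \<and> Q * P = 1\<^sub>m r}"

definition msum :: "nat \<Rightarrow> nat \<Rightarrow> (nat \<Rightarrow> real mat) \<Rightarrow> nat \<Rightarrow> real mat" where
  "msum a b F m = mat a b (\<lambda>(i,j). \<Sum>k<m. F k $$ (i,j))"

end

theory Submission
  imports Defs "HOL-Analysis.Convex"
begin

text \<open>
  Fix an iterate and transport it by a (nearly) optimal alignment P, so that X P is close to the true factor
  Xs and Y P^-T is close to Ys, with errors dx and dy. Optimality of P among all invertible matrices is the
  first-order condition (X P)^T dx = dy^T (Y P^-T). It makes the cross term of the squared norm of
  dx Y^T + X dy^T nonnegative, and this squared norm is what the RIP lets one extract from the gradient;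
  hence one gradient step contracts the squared error by 1 - eta / (2 kappa), up to perturbations caused by
  the RIP constant, by the deviation of P^T P from the identity and by the step sizes.

  The infimum over P need not be attained a priori. Moving P along the residual K of the first-order
  condition decreases the loss by a multiple of the squared norm of K, so every almost optimal P has a small
  K, which is enough.

  In the aligned coordinates a step is preconditioned by P^T P and its inverse, so these must stay within
  order kappa^(-1/2) of the identity. Consecutive alignments differ by a factor I + E with E of order
  dist / sqrt(sigma_min). The distances decay geometrically with ratio 1 - O(1 / kappa), so the total drift
  is of order kappa * dist_0 / sqrt(sigma_min), and the assumption on the initialization makes this of order
  kappa^(-1/2).
\<close>

section \<open>Finitely supported matrices\<close>

text \<open>The exponent 3/2 in the initialization comes from one scale comparison. Let
  \<open>l\<close> and \<open>u\<close> be the square roots of the extreme singular values. An error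
  of size x in a factor changes the product by at least about \<open>l\<close> x, while a Gram
  deviation w of the alignment perturbs the update direction by up to about \<open>u\<close> x w. So
  w must be of order \<open>l / u\<close>. The drift of the Gram matrices per step is of order
  distance / \<open>l\<close>, and about \<kappa> steps matter, whence an initial distance of order
  \<open>l\<close> times (\<open>l / u\<close>)^3. The distance is invariant under all invertible
  rebalancings of the factors, so a small distance says nothing about the Gram matrices. The
  orthogonal matrix in the initialization supplies this information at time 0, and the induction has
  to carry a concrete alignment besides the distance. The RIP controls the gradient only through its
  pairings with matrices of low rank. Its norm may be large, so both the linear and the quadratic
  term of a step are written as such pairings.\<close>

text \<open>
  Matrices of all sizes are embedded into one type of matrices with finitely many nonzero entries. It is
  both a real inner product space (with the Frobenius norm) and a normed algebra, without carrier side
  conditions; the only trace of the sizes is the support predicate fdim and the partial units idm r.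
\<close>

typedef fmat = "{f :: nat \<Rightarrow> nat \<Rightarrow> real. \<exists>n. \<forall>i j. f i j \<noteq> 0 \<longrightarrow> i < n \<and> j < n}"
  morphisms ent Abs_fmat
  by (rule exI[of _ "\<lambda>_ _. 0"]) simp

setup_lifting type_definition_fmat

lemma fmat_eqI: "(\<And>i j. ent A i j = ent B i j) \<Longrightarrow> A = B"
  by (simp add: ent_inject[symmetric] fun_eq_iff)

definition bnd :: "nat \<Rightarrow> fmat \<Rightarrow> bool" where
  "bnd n A \<longleftrightarrow> (\<forall>i j. ent A i j \<noteq> 0 \<longrightarrow> i < n \<and> j < n)"

lemma bnd_ex: "\<exists>n. bnd n A"
  using ent[of A] by (simp add: bnd_def)

lemma bnd_mono: "bnd n A \<Longrightarrow> n \<le> m \<Longrightarrow> bnd m A"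
  unfolding bnd_def by (meson less_le_trans)

lemma bnd_ex3: "\<exists>n. bnd n A \<and> bnd n B \<and> bnd n C"
proof -
  obtain a b c where "bnd a A" "bnd b B" "bnd c C"
    using bnd_ex by blast
  then have "bnd (a + b + c) A \<and> bnd (a + b + c) B \<and> bnd (a + b + c) C"
    by (auto intro: bnd_mono)
  then show ?thesis ..
qed

lemma bndD: "bnd n A \<Longrightarrow> \<not> (i < n \<and> j < n) \<Longrightarrow> ent A i j = 0"
  unfolding bnd_def by blast

definition size_bd :: "fmat \<Rightarrow> nat" where
  "size_bd A = (LEAST n. bnd n A)"

lemma bnd_size_bd: "bnd (size_bd A) A"
  unfolding size_bd_def using bnd_ex by (rule LeastI_ex)

lemma size_bd_le: "bnd n A \<Longrightarrow> size_bd A \<le> n"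
  unfolding size_bd_def by (rule Least_le)

lemma finite_support_combine:
  fixes f g h :: "nat \<Rightarrow> nat \<Rightarrow> real"
  assumes "\<exists>n. \<forall>i j. f i j \<noteq> 0 \<longrightarrow> i < n \<and> j < n" "\<exists>n. \<forall>i j. g i j \<noteq> 0 \<longrightarrow> i < n \<and> j < n"
    and h: "\<And>i j. h i j \<noteq> 0 \<Longrightarrow> f i j \<noteq> 0 \<or> g i j \<noteq> 0"
  shows "\<exists>n. \<forall>i j. h i j \<noteq> 0 \<longrightarrow> i < n \<and> j < n"
proof -
  obtain n m where n: "\<forall>i j. f i j \<noteq> 0 \<longrightarrow> i < n \<and> j < n" and m: "\<forall>i j. g i j \<noteq> 0 \<longrightarrow> i < m \<and> j < m"
    using assms by blast
  show ?thesis
  proof (intro exI allI impI)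
    fix i j assume "h i j \<noteq> 0"
    then show "i < n + m \<and> j < n + m" using h n m trans_less_add1 trans_less_add2 by blast
  qed
qed

section \<open>Vector space structure and Frobenius inner product\<close>

instantiation fmat :: real_vector
begin

lift_definition zero_fmat :: fmat is "\<lambda>_ _. 0" by simp
lift_definition plus_fmat :: "fmat \<Rightarrow> fmat \<Rightarrow> fmat" is "\<lambda>f g i j. f i j + g i j"
  by (rule finite_support_combine, assumption, assumption) auto
lift_definition uminus_fmat :: "fmat \<Rightarrow> fmat" is "\<lambda>f i j. - f i j" by simp
lift_definition minus_fmat :: "fmat \<Rightarrow> fmat \<Rightarrow> fmat" is "\<lambda>f g i j. f i j - g i j"
  by (rule finite_support_combine, assumption, assumption) auto
lift_definition scaleR_fmat :: "real \<Rightarrow> fmat \<Rightarrow> fmat" is "\<lambda>c f i j. c * f i j" by auto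

lemma ent_linear [simp]:
  "ent 0 i j = 0" "ent (A + B) i j = ent A i j + ent B i j" "ent (- A) i j = - ent A i j"
  "ent (A - B) i j = ent A i j - ent B i j" "ent (c *\<^sub>R A) i j = c * ent A i j"
  by (simp_all add: zero_fmat.rep_eq plus_fmat.rep_eq uminus_fmat.rep_eq minus_fmat.rep_eq scaleR_fmat.rep_eq)

instance
  by standard (auto intro!: fmat_eqI simp: algebra_simps)

end

instantiation fmat :: real_inner
begin

definition "inner_fmat A B = (\<Sum>p\<in>{..<size_bd A} \<times> {..<size_bd A}. ent A (fst p) (snd p) * ent B (fst p) (snd p))"
definition "norm_fmat A = sqrt (inner A (A :: fmat))"
definition "dist_fmat A B = norm (A - B :: fmat)"
definition "sgn_fmat A = A /\<^sub>R norm (A :: fmat)"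
definition "uniformity_fmat = (INF e\<in>{0 <..}. principal {(x, y :: fmat). dist x y < e})"
definition "open_fmat (U :: fmat set) = (\<forall>x\<in>U. eventually (\<lambda>(x', y). x' = x \<longrightarrow> y \<in> U) uniformity)"

text \<open>Entries outside the least square vanish, so every larger square gives the same sum.
  Identities between several matrices can then be checked on one common square.\<close>

lemma inner_bnd:
  assumes "bnd n A"
  shows "inner A B = (\<Sum>p\<in>{..<n} \<times> {..<n}. ent A (fst p) (snd p) * ent B (fst p) (snd p))"
  unfolding inner_fmat_def
proof (rule sum.mono_neutral_left)
  show "{..<size_bd A} \<times> {..<size_bd A} \<subseteq> {..<n} \<times> {..<n}"
    using size_bd_le[OF assms] by auto
  show "\<forall>p\<in>{..<n} \<times> {..<n} - {..<size_bd A} \<times> {..<size_bd A}. ent A (fst p) (snd p) * ent B (fst p) (snd p) = 0"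
  proof
    fix p assume "p \<in> {..<n} \<times> {..<n} - {..<size_bd A} \<times> {..<size_bd A}"
    then have "\<not> (fst p < size_bd A \<and> snd p < size_bd A)" by auto
    then show "ent A (fst p) (snd p) * ent B (fst p) (snd p) = 0"
      using bndD[OF bnd_size_bd[of A]] by simp
  qed
qed simp

instance
proof
  fix A B C :: fmat and c :: real and U :: "fmat set"
  obtain n where n: "bnd n A" "bnd n B" "bnd n (A + B)"
    using bnd_ex3 by blast
  obtain m where m: "bnd m A" "bnd m (c *\<^sub>R A)"
    using bnd_ex3 by blast
  show "dist A B = norm (A - B)" by (rule dist_fmat_def)
  show "sgn A = A /\<^sub>R norm A" by (rule sgn_fmat_def)
  show "uniformity = (INF e\<in>{0 <..}. principal {(x, y :: fmat). dist x y < e})" by (rule uniformity_fmat_def)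
  show "open U = (\<forall>x\<in>U. eventually (\<lambda>(x', y). x' = x \<longrightarrow> y \<in> U) uniformity)" by (rule open_fmat_def)
  show "norm A = sqrt (inner A A)" by (rule norm_fmat_def)
  show "inner A B = inner B A" by (simp add: inner_bnd[OF n(1)] inner_bnd[OF n(2)] mult.commute)
  show "inner (A + B) C = inner A C + inner B C"
    by (simp add: inner_bnd[OF n(1)] inner_bnd[OF n(2)] inner_bnd[OF n(3)] sum.distrib distrib_right)
  show "inner (c *\<^sub>R A) B = c * inner A B"
    by (simp add: inner_bnd[OF m(1)] inner_bnd[OF m(2)] sum_distrib_left mult.assoc)
  show "0 \<le> inner A A" by (simp add: inner_bnd[OF n(1)] sum_nonneg)
  show "inner A A = 0 \<longleftrightarrow> A = 0"
  proof
    assume "inner A A = 0"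
    then have "\<forall>p\<in>{..<n} \<times> {..<n}. ent A (fst p) (snd p) = 0"
      by (subst (asm) inner_bnd[OF n(1)], subst (asm) sum_nonneg_eq_0_iff) auto
    then show "A = 0" using bndD[OF n(1)] by (intro fmat_eqI) force
  qed (simp add: inner_fmat_def)
qed

end

lemma inner_bnd2:
  assumes "bnd n A"
  shows "inner A B = (\<Sum>i<n. \<Sum>j<n. ent A i j * ent B i j)"
  unfolding inner_bnd[OF assms] by (simp add: sum.cartesian_product split_beta)

section \<open>Matrix product and submultiplicativity of the Frobenius norm\<close>

instantiation fmat :: real_normed_algebra
begin

definition "times_fmat A B = Abs_fmat (\<lambda>i j. \<Sum>k<size_bd A. ent A i k * ent B k j)"

lemma ent_times_size: "ent (A * B) i j = (\<Sum>k<size_bd A. ent A i k * ent B k j)"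
  unfolding times_fmat_def
proof (subst Abs_fmat_inverse, clarify)
  obtain n where n: "bnd n A" "bnd n B" using bnd_ex3 by blast
  show "\<exists>n. \<forall>i j. (\<Sum>k<size_bd A. ent A i k * ent B k j) \<noteq> 0 \<longrightarrow> i < n \<and> j < n"
  proof (intro exI allI impI)
    fix i j assume "(\<Sum>k<size_bd A. ent A i k * ent B k j) \<noteq> 0"
    then obtain k where "ent A i k * ent B k j \<noteq> 0" by (meson sum.neutral)
    then show "i < n \<and> j < n" using bndD[OF n(1)] bndD[OF n(2)] by (metis mult_zero_left mult_zero_right)
  qed
qed simp

lemma ent_times:
  assumes "bnd n A \<or> bnd n B"
  shows "ent (A * B) i j = (\<Sum>k<n. ent A i k * ent B k j)"
proof -
  let ?m = "max n (size_bd A)"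
  have "ent (A * B) i j = (\<Sum>k<?m. ent A i k * ent B k j)"
    unfolding ent_times_size
    by (rule sum.mono_neutral_left) (auto simp: bndD[OF bnd_size_bd])
  also have "\<dots> = (\<Sum>k<n. ent A i k * ent B k j)"
    using assms by (intro sum.mono_neutral_right) (auto simp: bndD)
  finally show ?thesis .
qed

lemma bnd_times: "bnd n A \<Longrightarrow> bnd n B \<Longrightarrow> bnd n (A * B)"
  unfolding bnd_def
proof (intro allI impI)
  fix i j assume A: "\<forall>i j. ent A i j \<noteq> 0 \<longrightarrow> i < n \<and> j < n" and B: "\<forall>i j. ent B i j \<noteq> 0 \<longrightarrow> i < n \<and> j < n"
    and "ent (A * B) i j \<noteq> 0"
  then obtain k where "ent A i k * ent B k j \<noteq> 0" unfolding ent_times_size by (meson sum.neutral)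
  then show "i < n \<and> j < n" using A B by fastforce
qed

text \<open>Cauchy-Schwarz is applied to each entry of the product; the resulting bound is a row sum
  times a column sum and therefore factors.\<close>

lemma fmat_norm_mult:
  fixes A B :: fmat
  shows "norm (A * B) \<le> norm A * norm B"
proof -
  obtain n where n: "bnd n A" "bnd n B" using bnd_ex3 by blast
  have "inner (A * B) (A * B) = (\<Sum>i<n. \<Sum>j<n. (\<Sum>k<n. ent A i k * ent B k j)\<^sup>2)"
    by (simp add: inner_bnd2[OF bnd_times[OF n]] ent_times[OF disjI1[OF n(1)]] power2_eq_square)
  also have "\<dots> \<le> (\<Sum>i<n. \<Sum>j<n. (\<Sum>k<n. (ent A i k)\<^sup>2) * (\<Sum>k<n. (ent B k j)\<^sup>2))"
    by (intro sum_mono Cauchy_Schwarz_ineq_sum)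
  also have "\<dots> = (\<Sum>i<n. \<Sum>k<n. (ent A i k)\<^sup>2) * (\<Sum>j<n. \<Sum>k<n. (ent B k j)\<^sup>2)"
    by (simp add: sum_product)
  also have "(\<Sum>j<n. \<Sum>k<n. (ent B k j)\<^sup>2) = (\<Sum>k<n. \<Sum>j<n. (ent B k j)\<^sup>2)"
    by (rule sum.swap)
  finally have "inner (A * B) (A * B) \<le> inner A A * inner B B"
    by (simp add: inner_bnd2[OF n(1)] inner_bnd2[OF n(2)] power2_eq_square)
  then show ?thesis
    by (simp add: norm_fmat_def real_sqrt_mult[symmetric])
qed

instance
proof
  fix A B C :: fmat and c :: real
  obtain n where n: "bnd n A" "bnd n B" "bnd n C"
    using bnd_ex3 by blast
  obtain m where m: "bnd m (A + B)" "bnd m A" "bnd m B"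
    using bnd_ex3 by blast
  obtain l where l: "bnd l (c *\<^sub>R A)" "bnd l A"
    using bnd_ex3 by blast
  note e = ent_times[OF disjI1]
  have "(\<Sum>k<n. (\<Sum>l<n. ent A i l * ent B l k) * ent C k j) = (\<Sum>l<n. ent A i l * (\<Sum>k<n. ent B l k * ent C k j))" for i j
    by (simp add: sum_distrib_left sum_distrib_right mult.assoc) (rule sum.swap)
  then show "A * B * C = A * (B * C)"
    by (intro fmat_eqI) (simp add: e[OF n(1)] e[OF n(2)] e[OF bnd_times[OF n(1,2)]])
  show "(A + B) * C = A * C + B * C"
    by (intro fmat_eqI) (simp add: e[OF m(1)] e[OF m(2)] e[OF m(3)] sum.distrib distrib_right)
  show "A * (B + C) = A * B + A * C"
    by (intro fmat_eqI) (simp add: e[OF n(1)] sum.distrib distrib_left)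
  show "c *\<^sub>R A * B = c *\<^sub>R (A * B)"
    by (intro fmat_eqI) (simp add: e[OF l(1)] e[OF l(2)] sum_distrib_left mult.assoc)
  show "A * c *\<^sub>R B = c *\<^sub>R (A * B)"
    by (intro fmat_eqI) (simp add: e[OF n(1)] sum_distrib_left mult.left_commute)
  show "norm (A * B) \<le> norm A * norm B" by (rule fmat_norm_mult)
qed

end

section \<open>Transposition and adjoints\<close>

lift_definition tr :: "fmat \<Rightarrow> fmat" is "\<lambda>f i j. f j i" by blast

lemma ent_tr [simp]: "ent (tr A) i j = ent A j i"
  by (simp add: tr.rep_eq)

lemma bnd_tr: "bnd n A \<Longrightarrow> bnd n (tr A)"
  unfolding bnd_def by auto

lemma tr_linear [simp]:
  "tr 0 = 0" "tr (A + B) = tr A + tr B" "tr (A - B) = tr A - tr B" "tr (- A) = - tr A"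
  "tr (c *\<^sub>R A) = c *\<^sub>R tr A" "tr (tr A) = A"
  by (auto intro!: fmat_eqI)

lemma tr_times [simp]: "tr (A * B) = tr B * tr A"
proof -
  obtain n where n: "bnd n A" "bnd n B" using bnd_ex3 by blast
  show ?thesis
    by (intro fmat_eqI)
       (simp add: ent_times[OF disjI1[OF n(1)]] ent_times[OF disjI1[OF bnd_tr[OF n(2)]]] mult.commute)
qed

lemma inner_tr [simp]: "inner (tr A) (tr B) = inner A B"
proof -
  obtain n where n: "bnd n A" using bnd_ex by blast
  show ?thesis
    by (simp add: inner_bnd2[OF n] inner_bnd2[OF bnd_tr[OF n]]) (rule sum.swap)
qed

lemma norm_tr [simp]: "norm (tr A) = norm A"
  by (simp add: norm_eq_sqrt_inner)

text \<open>Left multiplication has the transpose as its adjoint: both sides are the same triple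
  sum. All later manipulations of cross terms rest on this and on its mirror image.\<close>

lemma inner_mult_left: "inner (A * B) C = inner B (tr A * C)"
proof -
  obtain n where n: "bnd n A" "bnd n B" using bnd_ex3 by blast
  have "inner (A * B) C = (\<Sum>i<n. \<Sum>j<n. \<Sum>k<n. ent A i k * ent B k j * ent C i j)"
    by (simp add: inner_bnd2[OF bnd_times[OF n]] ent_times[OF disjI1[OF n(1)]] sum_distrib_right)
  also have "\<dots> = (\<Sum>k<n. \<Sum>j<n. \<Sum>i<n. ent A i k * ent B k j * ent C i j)"
  proof -
    have "(\<Sum>i<n. \<Sum>j<n. \<Sum>k<n. f i j k) = (\<Sum>k<n. \<Sum>j<n. \<Sum>i<n. f i j k)" for f :: "nat \<Rightarrow> nat \<Rightarrow> nat \<Rightarrow> real"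
    proof -
      have "(\<Sum>i<n. \<Sum>j<n. \<Sum>k<n. f i j k) = (\<Sum>i<n. \<Sum>k<n. \<Sum>j<n. f i j k)"
        by (intro sum.cong refl sum.swap)
      also have "\<dots> = (\<Sum>k<n. \<Sum>i<n. \<Sum>j<n. f i j k)" by (rule sum.swap)
      also have "\<dots> = (\<Sum>k<n. \<Sum>j<n. \<Sum>i<n. f i j k)"
        by (intro sum.cong refl sum.swap)
      finally show ?thesis .
    qed
    then show ?thesis .
  qed
  also have "\<dots> = inner B (tr A * C)"
    by (simp add: inner_bnd2[OF n(2)] ent_times[OF disjI1[OF bnd_tr[OF n(1)]]] sum_distrib_left mult_ac)
  finally show ?thesis .
qed

lemma inner_mult_right: "inner (A * B) C = inner A (C * tr B)"
  using inner_mult_left[of "tr B" "tr A" "tr C"] by (metis inner_tr tr_linear(6) tr_times)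

section \<open>Rectangular supports and partial units\<close>

definition fdim :: "nat \<Rightarrow> nat \<Rightarrow> fmat \<Rightarrow> bool" where
  "fdim a b A \<longleftrightarrow> (\<forall>i j. ent A i j \<noteq> 0 \<longrightarrow> i < a \<and> j < b)"

lemma fdimD: "fdim a b A \<Longrightarrow> \<not> (i < a \<and> j < b) \<Longrightarrow> ent A i j = 0"
  unfolding fdim_def by blast

lemma fdim_linear [intro]:
  "fdim a b 0" "fdim a b A \<Longrightarrow> fdim a b B \<Longrightarrow> fdim a b (A + B)"
  "fdim a b A \<Longrightarrow> fdim a b B \<Longrightarrow> fdim a b (A - B)"
  "fdim a b A \<Longrightarrow> fdim a b (- A)"
  "fdim a b A \<Longrightarrow> fdim a b (c *\<^sub>R A)" "fdim a b A \<Longrightarrow> fdim b a (tr A)"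
  unfolding fdim_def by auto (metis add.right_neutral diff_0_right)+

lemma fdim_times [intro]: "fdim a b A \<Longrightarrow> fdim b c B \<Longrightarrow> fdim a c (A * B)"
proof -
  assume A: "fdim a b A" and B: "fdim b c B"
  show ?thesis unfolding fdim_def
  proof (intro allI impI)
    fix i j assume "ent (A * B) i j \<noteq> 0"
    then obtain k where "ent A i k * ent B k j \<noteq> 0" unfolding ent_times_size by (meson sum.neutral)
    then show "i < a \<and> j < c" using A B unfolding fdim_def by fastforce
  qed
qed

text \<open>The full identity has infinite support, so the algebra has no unit. The truncations are
  units only on matrices whose rows or columns fit, which is why later identities appeal to
  \<open>times_idm\<close> and \<open>idm_times\<close> with a support fact.\<close>

lift_definition idm :: "nat \<Rightarrow> fmat" is "\<lambda>r i j. if i < r \<and> i = j then 1 else 0"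
  by auto

lemma ent_idm: "ent (idm r) i j = (if i < r \<and> i = j then 1 else 0)"
  by (simp add: idm.rep_eq)

lemma bnd_idm: "bnd r (idm r)" by (auto simp: bnd_def ent_idm)

lemma fdim_idm [intro]: "fdim r r (idm r)" by (auto simp: fdim_def ent_idm)

lemma tr_idm [simp]: "tr (idm r) = idm r" by (auto intro!: fmat_eqI simp: ent_idm)

lemma times_idm: "fdim a r A \<Longrightarrow> A * idm r = A"
proof (rule fmat_eqI)
  fix i j assume A: "fdim a r A"
  have "ent (A * idm r) i j = (\<Sum>k<r. if k = j then ent A i k else 0)"
    unfolding ent_times[OF disjI2[OF bnd_idm]] by (intro sum.cong) (auto simp: ent_idm)
  then show "ent (A * idm r) i j = ent A i j"
    using fdimD[OF A, of i j] by auto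
qed

lemma idm_times: "fdim r a A \<Longrightarrow> idm r * A = A"
  using times_idm[of a r "tr A"] fdim_linear(6) by (metis tr_idm tr_linear(6) tr_times)

section \<open>The restricted isometry property in polarized form\<close>

text \<open>Let \<open>b\<close> be the bilinear defect between the measured and the true inner
  product. Polarization expresses it through its values at H1 + H2 and H1 - H2, and the
  parallelogram law adds up the two bounds. Sums of two \<open>low\<close> matrices are where the
  doubled rank of the RIP is spent.\<close>

lemma polarized_rip:
  fixes A :: "nat \<Rightarrow> 'a::real_inner"
  assumes rip: "\<And>H1 H2. low H1 \<Longrightarrow> low H2 \<Longrightarrow>
      \<bar>(\<Sum>i<m. (inner (A i) (H1 + H2))\<^sup>2) - (norm (H1 + H2))\<^sup>2\<bar> \<le> \<delta> * (norm (H1 + H2))\<^sup>2"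
    and scale: "\<And>c H. low H \<Longrightarrow> low (c *\<^sub>R H)"
    and low: "low H1" "low H2"
  shows "\<bar>(\<Sum>i<m. inner (A i) H1 * inner (A i) H2) - inner H1 H2\<bar> \<le> \<delta> * norm H1 * norm H2"
proof -
  define b where "b H1 H2 = (\<Sum>i<m. inner (A i) H1 * inner (A i) H2) - inner H1 H2" for H1 H2
  have badd: "b (H1 + s *\<^sub>R H2) (H1 + s *\<^sub>R H2) = b H1 H1 + 2 * s * b H1 H2 + s\<^sup>2 * b H2 H2" for H1 H2 s
  proof -
    have "(\<Sum>i<m. inner (A i) (H1 + s *\<^sub>R H2) * inner (A i) (H1 + s *\<^sub>R H2)) =
       (\<Sum>i<m. inner (A i) H1 * inner (A i) H1 + 2 * s * (inner (A i) H1 * inner (A i) H2) + s\<^sup>2 * (inner (A i) H2 * inner (A i) H2))"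
      by (intro sum.cong refl) (simp add: inner_add_right algebra_simps power2_eq_square)
    then show ?thesis
      unfolding b_def
      by (simp add: sum.distrib sum_distrib_left inner_add_left inner_add_right inner_commute[of H2 H1] algebra_simps power2_eq_square)
  qed
  have quad: "\<bar>b H1 H2\<bar> \<le> \<delta> * ((norm H1)\<^sup>2 + (norm H2)\<^sup>2) / 2" if "low H1" "low H2" for H1 H2
  proof -
    have q: "\<bar>b (H1 + s *\<^sub>R H2) (H1 + s *\<^sub>R H2)\<bar> \<le> \<delta> * (norm (H1 + s *\<^sub>R H2))\<^sup>2" for s
      using rip[OF that(1) scale[OF that(2), of s]] unfolding b_def
      by (simp add: power2_eq_square power2_norm_eq_inner[unfolded power2_eq_square])
    have "(norm (H1 + 1 *\<^sub>R H2))\<^sup>2 + (norm (H1 + (-1) *\<^sub>R H2))\<^sup>2 = 2 * ((norm H1)\<^sup>2 + (norm H2)\<^sup>2)"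
      by (simp add: power2_norm_eq_inner inner_add_left inner_add_right inner_diff_left inner_diff_right)
    then have "\<delta> * (norm (H1 + 1 *\<^sub>R H2))\<^sup>2 + \<delta> * (norm (H1 + (-1) *\<^sub>R H2))\<^sup>2
        = 2 * (\<delta> * ((norm H1)\<^sup>2 + (norm H2)\<^sup>2))"
      by (metis distrib_left mult.left_commute)
    moreover have "b (H1 + 1 *\<^sub>R H2) (H1 + 1 *\<^sub>R H2) - b (H1 + (-1) *\<^sub>R H2) (H1 + (-1) *\<^sub>R H2) = 4 * b H1 H2"
      unfolding badd by simp
    ultimately show ?thesis using q[of 1] q[of "-1"] by linarith
  qed
  show ?thesis
  proof (cases "H1 = 0 \<or> H2 = 0")
    case True then show ?thesis by auto
  next
    case False
    \<comment> \<open>\<open>quad\<close> bounds the defect by a mean of squared norms; on unit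
      vectors this mean is 1, and homogeneity then turns it into the product of the norms.\<close>
    let ?G1 = "(1 / norm H1) *\<^sub>R H1" and ?G2 = "(1 / norm H2) *\<^sub>R H2"
    have n: "norm H1 > 0" "norm H2 > 0" using False by auto
    have "\<bar>b ?G1 ?G2\<bar> \<le> \<delta>"
      using quad[OF scale scale, OF low, of "1 / norm H1" "1 / norm H2"] n by simp
    moreover have "b ?G1 ?G2 = b H1 H2 / (norm H1 * norm H2)"
      unfolding b_def using n by (simp add: field_simps sum_distrib_left sum_divide_distrib)
    ultimately have "\<bar>b H1 H2\<bar> \<le> \<delta> * (norm H1 * norm H2)"
      using n by (simp add: abs_div_pos[symmetric] pos_divide_le_eq del: abs_div_pos)
    then show ?thesis unfolding b_def by (simp add: mult.assoc)
  qed
qed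

text \<open>Rank at most r, encoded as a factorization through dimension r. The matrices to be
  tested against the gradient arise as such products, so actual rank is needed only where the RIP
  hypothesis is invoked.\<close>

definition low :: "nat \<Rightarrow> nat \<Rightarrow> nat \<Rightarrow> fmat \<Rightarrow> bool" where
  "low n1 n2 r H \<longleftrightarrow> (\<exists>L R. fdim n1 r L \<and> fdim r n2 R \<and> H = L * R)"

lemma lowI: "fdim n1 r L \<Longrightarrow> fdim r n2 R \<Longrightarrow> low n1 n2 r (L * R)"
  unfolding low_def by blast

lemma low_scale: "low n1 n2 r H \<Longrightarrow> low n1 n2 r (c *\<^sub>R H)"
  unfolding low_def by (metis fdim_linear(5) mult_scaleR_left)

lemma norm_sub_scale: "(norm (x - c *\<^sub>R y))\<^sup>2 = (norm x)\<^sup>2 - 2 * c * inner y x + c\<^sup>2 * (norm y)\<^sup>2" for x y :: "'a::real_inner"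
  unfolding power2_norm_eq_inner
  by (simp add: inner_diff_left inner_diff_right inner_commute[of x y] algebra_simps power2_eq_square)

section \<open>One gradient step in aligned coordinates\<close>

text \<open>\<open>u\<close> and \<open>l\<close> are meant as the square roots of the largest and
  the smallest singular value. The singular value decomposition enters the dynamics only through
  these two-sided bounds. The lower ones require support in r rows, since rows of B beyond r are
  annihilated by \<open>Xs\<close> and \<open>Ys\<close>.\<close>

locale ground_truth =
  fixes n1 n2 r :: nat and Xs Ys :: fmat and u l :: real
  assumes dXs: "fdim n1 r Xs" and dYs: "fdim n2 r Ys"
    and l0: "0 < l" and lu: "l \<le> u"
    and upX: "\<And>B. norm (Xs * B) \<le> u * norm B" and upY: "\<And>B. norm (Ys * B) \<le> u * norm B"
    and loX: "\<And>B k. fdim r k B \<Longrightarrow> l * norm B \<le> norm (Xs * B)"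
    and loY: "\<And>B k. fdim r k B \<Longrightarrow> l * norm B \<le> norm (Ys * B)"
begin

lemma u0: "0 < u" using l0 lu by linarith

text \<open>The adjoint of the measurement operator applied to the residual. It depends on X and Y
  only through X Y^T and is therefore the same in all aligned coordinates.\<close>

definition grad :: "(nat \<Rightarrow> fmat) \<Rightarrow> nat \<Rightarrow> fmat \<Rightarrow> fmat \<Rightarrow> fmat" where
  "grad A m X Y = (\<Sum>i<m. inner (A i) (X * tr Y - Xs * tr Ys) *\<^sub>R A i)"

text \<open>Expanding the squares leaves a linear term, the pairing of the gradient with two
  matrices of rank r, and a quadratic term. By the RIP the linear term is close to the squared norm
  of \<open>T1 + T2\<close>, the linearized residual; the quadratic one carries an additional factor
  \<open>eta\<close> and is absorbed. \<open>Om\<close> and \<open>Om'\<close> stand for P^T P - I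
  and Q Q^T - I, with Q the inverse of P, which appear when the step is written in aligned
  coordinates.\<close>

lemma one_step:
  fixes X Y Om Om' :: fmat
  defines "dx \<equiv> X - Xs" and "dy \<equiv> Y - Ys"
  defines "K \<equiv> tr X * dx - tr dy * Y"
  assumes rip: "\<And>H1 H2. low n1 n2 r H1 \<Longrightarrow> low n1 n2 r H2 \<Longrightarrow>
      \<bar>(\<Sum>i<m. inner (A i) H1 * inner (A i) H2) - inner H1 H2\<bar> \<le> 1/200 * norm H1 * norm H2"
    and dA: "\<And>i. i < m \<Longrightarrow> fdim n1 n2 (A i)"
    and dX: "fdim n1 r X" and dY: "fdim n2 r Y"
    and dOm: "fdim r r Om" "fdim r r Om'"
    and Om: "norm Om \<le> l / (200 * u)" "norm Om' \<le> l / (200 * u)"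
    and small: "norm dx \<le> l / 200" "norm dy \<le> l / 200"
    and eta: "0 < eta" "eta \<le> 1/1000"
    and a: "\<bar>a - eta / u\<^sup>2\<bar> \<le> eta / u\<^sup>2 / 200" and b: "\<bar>b - eta / u\<^sup>2\<bar> \<le> eta / u\<^sup>2 / 200"
  shows "(norm (dx - a *\<^sub>R (grad A m X Y * (Y * (idm r + Om)))))\<^sup>2
       + (norm (dy - b *\<^sub>R (tr (grad A m X Y) * (X * (idm r + Om')))))\<^sup>2
     \<le> (1 - eta * l\<^sup>2 / (2 * u\<^sup>2)) * ((norm dx)\<^sup>2 + (norm dy)\<^sup>2) + eta / u\<^sup>2 * (norm K)\<^sup>2"
proof -
  define G where "G = grad A m X Y"
  define W where "W = idm r + Om"
  define W' where "W' = idm r + Om'"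
  \<comment> \<open>The residual \<open>E\<close> equals \<open>T1 + T2 - Z\<close>: two first-order
    parts, taken at the current point instead of the truth, and a second-order correction.\<close>
  define T1 where "T1 = dx * tr Y"
  define T2 where "T2 = X * tr dy"
  define Z where "Z = dx * tr dy"
  define E where "E = X * tr Y - Xs * tr Ys"
  define x where "x = norm dx"
  define y where "y = norm dy"
  define e where "e = norm T1"
  define f where "f = norm T2"
  define z where "z = norm Z"
  define k where "k = norm K"
  define N where "N = e + f"
  define c where "c = eta / u\<^sup>2"
  note u0 = u0
  have ddx: "fdim n1 r dx" unfolding dx_def using dX dXs by auto
  have ddy: "fdim n2 r dy" unfolding dy_def using dY dYs by auto
  have tdy: "fdim r n2 (tr dy)" using ddy by auto
  have tdx: "fdim r n1 (tr dx)" using ddx by auto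
  have dW: "fdim r r W" "fdim r r W'" unfolding W_def W'_def using dOm by auto
  have dG: "fdim n1 n2 G"
    unfolding G_def grad_def using dA by (induction m) auto
  have nn: "0 \<le> x" "0 \<le> y" "0 \<le> e" "0 \<le> f" "0 \<le> z" "0 \<le> k" "0 \<le> N"
    unfolding x_def y_def e_def f_def z_def k_def N_def by auto
  have a': "\<bar>a - c\<bar> \<le> c / 200" and b': "\<bar>b - c\<bar> \<le> c / 200" using a b unfolding c_def by auto
  have c0: "0 < c" unfolding c_def using eta u0 by simp
  have EE: "E = T1 + T2 - Z" "E = T1 + Xs * tr dy" "Xs * tr dy = T2 - Z"
    unfolding E_def T1_def T2_def Z_def dx_def dy_def by (simp_all add: algebra_simps)
  have xy: "x \<le> l / 200" "y \<le> l / 200" using small unfolding x_def y_def by auto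
  have zxy: "z \<le> x * y" unfolding z_def x_def y_def Z_def using norm_mult_ineq[of dx "tr dy"] by simp
  have loe: "199/200 * (l * x) \<le> e"
  proof -
    have "dx * tr Ys = T1 - Z" unfolding T1_def Z_def dy_def by (simp add: algebra_simps)
    then have "norm (dx * tr Ys) \<le> e + z" unfolding e_def z_def by (metis norm_triangle_ineq4)
    moreover have "l * x \<le> norm (dx * tr Ys)"
      using loY[OF tdx] norm_tr[of "Ys * tr dx"] unfolding x_def by simp
    moreover have "x * y \<le> x * (l/200)" using xy nn by (intro mult_left_mono) auto
    ultimately show ?thesis using zxy by (simp add: algebra_simps)
  qed
  have lof: "199/200 * (l * y) \<le> f"
  proof -
    have "norm (Xs * tr dy) \<le> f + z" unfolding EE(3) f_def z_def by (rule norm_triangle_ineq4)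
    moreover have "l * y \<le> norm (Xs * tr dy)" using loX[OF tdy] unfolding y_def by simp
    moreover have "x * y \<le> (l/200) * y" using xy nn by (intro mult_right_mono) auto
    ultimately show ?thesis using zxy by (simp add: algebra_simps)
  qed
  have zf: "z \<le> f / 100"
  proof -
    have "x * y \<le> (l/200) * y" using xy nn by (intro mult_right_mono) auto
    then show ?thesis using zxy lof nn l0 mult_nonneg_nonneg[of l y] by linarith
  qed
  have opY: "norm (B * tr Y) \<le> 2 * u * norm B" for B
  proof -
    have "B * tr Y = B * tr Ys + B * tr dy" unfolding dy_def by (simp add: algebra_simps)
    then have "norm (B * tr Y) \<le> norm (B * tr Ys) + norm (B * tr dy)" by (metis norm_triangle_ineq)
    moreover have "norm (B * tr Ys) \<le> u * norm B"
      using upY[of "tr B"] norm_tr[of "Ys * tr B"] by simp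
    moreover have "norm (B * tr dy) \<le> norm B * y" unfolding y_def using norm_mult_ineq[of B "tr dy"] by simp
    moreover have "norm B * y \<le> norm B * u" using xy l0 lu by (intro mult_left_mono) auto
    ultimately show ?thesis by (simp add: algebra_simps)
  qed
  have opX: "norm (X * B) \<le> 2 * u * norm B" for B
  proof -
    have "X * B = Xs * B + dx * B" unfolding dx_def by (simp add: algebra_simps)
    then have "norm (X * B) \<le> norm (Xs * B) + norm (dx * B)" by (metis norm_triangle_ineq)
    moreover have "norm (dx * B) \<le> x * norm B" unfolding x_def using norm_mult_ineq[of dx "B"] by simp
    moreover have "x * norm B \<le> u * norm B" using xy l0 lu by (intro mult_right_mono) auto
    ultimately show ?thesis using upX[of B] by (simp add: algebra_simps)
  qed
  have om1: "l / (200 * u) \<le> 1" using l0 lu u0 by (simp add: field_simps)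
  \<comment> \<open>The contributions of the Gram deviations. Their size is at most about
    \<open>u\<close> times the deviation times x or y, whereas \<open>e\<close> and \<open>f\<close>
    are only known to exceed about \<open>l\<close> x and \<open>l\<close> y; this is why deviations
    of order \<open>l / u\<close> are required.\<close>
  define R1 where "R1 = dx * tr Om * tr Y"
  define R2 where "R2 = X * (Om' * tr dy)"
  have R1: "norm R1 \<le> e / 50"
  proof -
    have "norm R1 \<le> 2 * u * norm (dx * tr Om)" unfolding R1_def by (rule opY)
    also have "\<dots> \<le> 2 * u * (x * (l / (200 * u)))"
    proof (intro mult_left_mono)
      have "norm (dx * tr Om) \<le> x * norm Om" unfolding x_def using norm_mult_ineq[of dx "tr Om"] by simp
      also have "\<dots> \<le> x * (l / (200 * u))" using Om nn by (intro mult_left_mono) auto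
      finally show "norm (dx * tr Om) \<le> x * (l / (200 * u))" .
    qed (use u0 in auto)
    also have "\<dots> = l * x / 100" using u0 by (simp add: field_simps)
    finally show ?thesis using loe nn l0 mult_nonneg_nonneg[of l x] by linarith
  qed
  have R2: "norm R2 \<le> f / 50"
  proof -
    have "norm R2 \<le> 2 * u * norm (Om' * tr dy)" unfolding R2_def by (rule opX)
    also have "\<dots> \<le> 2 * u * ((l / (200 * u)) * y)"
    proof (intro mult_left_mono)
      have "norm (Om' * tr dy) \<le> norm Om' * y" unfolding y_def using norm_mult_ineq[of Om' "tr dy"] by simp
      also have "\<dots> \<le> (l / (200 * u)) * y" using Om nn by (intro mult_right_mono) auto
      finally show "norm (Om' * tr dy) \<le> (l / (200 * u)) * y" .
    qed (use u0 in auto)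
    also have "\<dots> = l * y / 100" using u0 by (simp add: field_simps)
    finally show ?thesis using lof nn l0 mult_nonneg_nonneg[of l y] by linarith
  qed
  have normE: "norm E \<le> 101/100 * N"
  proof -
    have "norm E \<le> norm (T1 + T2) + z" unfolding EE(1) z_def by (rule norm_triangle_ineq4)
    then have "norm E \<le> N + z" unfolding N_def e_def f_def using norm_triangle_ineq[of T1 T2] by linarith
    then show ?thesis using zf nn unfolding N_def by simp
  qed
  \<comment> \<open>E has rank 2r, so the RIP of order 2r is applied to its two rank-r pieces separately\<close>
  have GE: "\<bar>inner G H - inner E H\<bar> \<le> N / 100 * norm H" if "low n1 n2 r H" for H
  proof -
    have l1: "low n1 n2 r T1" unfolding T1_def using ddx dY by (intro lowI) auto
    have l2: "low n1 n2 r (Xs * tr dy)" using dXs ddy by (intro lowI) auto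
    have s: "inner G H = (\<Sum>i<m. inner (A i) T1 * inner (A i) H) + (\<Sum>i<m. inner (A i) (Xs * tr dy) * inner (A i) H)"
      unfolding G_def grad_def E_def[symmetric] EE(2)
      by (simp add: inner_sum_left inner_add_right sum.distrib distrib_right)
    have "inner E H = inner T1 H + inner (Xs * tr dy) H" unfolding EE(2) by (simp add: inner_add_left)
    then have "\<bar>inner G H - inner E H\<bar> \<le> 1/200 * norm T1 * norm H + 1/200 * norm (Xs * tr dy) * norm H"
      using rip[OF l1 that] rip[OF l2 that] s by linarith
    also have "\<dots> = 1/200 * (e + norm (Xs * tr dy)) * norm H" unfolding e_def by (simp add: algebra_simps)
    also have "\<dots> \<le> N / 100 * norm H"
    proof (intro mult_right_mono)
      have "norm (Xs * tr dy) \<le> f + z" unfolding EE(3) f_def z_def by (rule norm_triangle_ineq4)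
      then show "1/200 * (e + norm (Xs * tr dy)) \<le> N / 100" using zf nn unfolding N_def by simp
    qed simp
    finally show ?thesis .
  qed
  have EH: "\<bar>inner E H\<bar> \<le> 101/100 * N * norm H" for H
    using Cauchy_Schwarz_ineq2[of E H] mult_right_mono[OF normE, of "norm H"] by simp
  have GH: "\<bar>inner G H\<bar> \<le> 2 * N * norm H" if "low n1 n2 r H" for H
  proof -
    have "0 \<le> N * norm H" using nn by simp
    moreover have "N / 100 * norm H = (N * norm H) / 100" "101/100 * N * norm H = 101/100 * (N * norm H)"
      "2 * N * norm H = 2 * (N * norm H)" by auto
    ultimately show ?thesis using GE[OF that] EH[of H] by linarith
  qed
  define H1 where "H1 = dx * tr (Y * W)"
  define H2 where "H2 = (X * W') * tr dy"
  have H1: "H1 = T1 + R1" unfolding H1_def T1_def R1_def W_def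
    using times_idm[OF dY] by (simp add: algebra_simps idm_times[of r n2 "tr Y"] fdim_linear(6)[OF dY])
  have H2: "H2 = T2 + R2" unfolding H2_def T2_def R2_def W'_def
    using times_idm[OF dX] by (simp add: algebra_simps)
  have lows: "low n1 n2 r T1" "low n1 n2 r R1" "low n1 n2 r T2" "low n1 n2 r R2"
  proof -
    show "low n1 n2 r T1" unfolding T1_def using ddx dY by (intro lowI) auto
    show "low n1 n2 r R1" unfolding R1_def using ddx dY dOm by (intro lowI) auto
    show "low n1 n2 r T2" unfolding T2_def using ddy dX by (intro lowI) auto
    show "low n1 n2 r R2" unfolding R2_def using ddy dX dOm by (intro lowI) auto
  qed
  \<comment> \<open>Replacing the gradient by E costs 1/100 and the perturbation R costs 2 * 1/50,
    together 1/20; the relative error 1/200 of the step size adds little more, and 7/100 covers the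
    total.\<close>
  have step: "c * inner E T - 7/100 * (c * (N * norm T)) \<le> g * inner G (T + R)"
    if T: "low n1 n2 r T" and R: "low n1 n2 r R" and nR: "norm R \<le> norm T / 50" and g: "\<bar>g - c\<bar> \<le> c / 200" for T R g
  proof -
    have p: "0 \<le> N * norm T" using nn by simp
    have "N * norm R \<le> N * (norm T / 50)" using nR nn by (intro mult_left_mono)
    then have d: "\<bar>inner G (T + R) - inner E T\<bar> \<le> N * norm T / 20"
    proof -
      have "N / 100 * norm T = (N * norm T) / 100" "2 * N * norm R = 2 * (N * norm R)" by auto
      moreover have "N * (norm T / 50) = (N * norm T) / 50" by simp
      ultimately show ?thesis
        using GE[OF T] GH[OF R] \<open>N * norm R \<le> N * (norm T / 50)\<close> unfolding inner_add_right by linarith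
    qed
    have "\<bar>g\<bar> \<le> 201/200 * c" using g by linarith
    then have "\<bar>g * (inner G (T + R) - inner E T)\<bar> \<le> 201/200 * c * (N * norm T / 20)"
      unfolding abs_mult using d c0 by (intro mult_mono) auto
    moreover have "\<bar>(g - c) * inner E T\<bar> \<le> c / 200 * (101/100 * N * norm T)"
      unfolding abs_mult using g EH[of T] c0 by (intro mult_mono) auto
    moreover have "g * inner G (T + R) = c * inner E T + g * (inner G (T + R) - inner E T) + (g - c) * inner E T"
      by (simp add: algebra_simps)
    moreover have "0 \<le> c * (N * norm T)" using p c0 by simp
    ultimately show ?thesis by (simp add: abs_le_iff)
  qed
  \<comment> \<open>the two factors of the cross term agree up to K, so it is almost a square\<close>
  have crossT: "inner T1 T2 \<ge> - k\<^sup>2 / 4"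
  proof -
    let ?A = "tr X * dx"
    have "inner T1 T2 = inner (X * tr dy) (dx * tr Y)" unfolding T1_def T2_def by (rule inner_commute)
    also have "\<dots> = inner (tr dy) (tr X * dx * tr Y)" by (simp add: inner_mult_left mult.assoc)
    also have "\<dots> = inner (tr dy * Y) ?A" by (simp add: inner_mult_right)
    also have "\<dots> = inner (?A - K) ?A" unfolding K_def by simp
    also have "\<dots> = (norm (?A - (1/2) *\<^sub>R K))\<^sup>2 - (norm K)\<^sup>2 / 4"
      unfolding norm_sub_scale by (simp add: inner_diff_left power2_norm_eq_inner power_divide)
    finally show ?thesis unfolding k_def by simp
  qed
  have N2: "N\<^sup>2 \<le> 2 * (e\<^sup>2 + f\<^sup>2)"
    using sum_squares_bound[of e f] unfolding N_def by (simp add: power2_sum)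
  \<comment> \<open>The losses are 1/100 from \<open>Z\<close> and 7/100 from \<open>step\<close>,
    both relative to N^2, which is at most 2 (e^2 + f^2). This leaves 1 - 2 * 8/100 =
    84/100.\<close>
  have first: "c * (84/100 * (e\<^sup>2 + f\<^sup>2) - k\<^sup>2 / 2) \<le> a * inner G H1 + b * inner G H2"
  proof -
    have "inner E (T1 + T2) = (norm (T1 + T2))\<^sup>2 - inner Z (T1 + T2)"
      unfolding EE(1) by (simp add: inner_diff_left inner_add_left inner_add_right power2_norm_eq_inner)
    moreover have "(norm (T1 + T2))\<^sup>2 = e\<^sup>2 + f\<^sup>2 + 2 * inner T1 T2"
      unfolding e_def f_def by (simp add: power2_norm_eq_inner inner_add_left inner_add_right inner_commute)
    moreover have "\<bar>inner Z (T1 + T2)\<bar> \<le> N / 100 * N"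
    proof -
      have "\<bar>inner Z (T1 + T2)\<bar> \<le> z * norm (T1 + T2)" unfolding z_def by (rule Cauchy_Schwarz_ineq2)
      also have "\<dots> \<le> N / 100 * N"
      proof (rule mult_mono)
        show "z \<le> N / 100" using zf nn unfolding N_def by simp
        show "norm (T1 + T2) \<le> N" unfolding N_def e_def f_def by (rule norm_triangle_ineq)
      qed (use nn in auto)
      finally show ?thesis .
    qed
    moreover have "N / 100 * N = N\<^sup>2 / 100" by (simp add: power2_eq_square)
    moreover have "inner E (T1 + T2) = inner E T1 + inner E T2" by (rule inner_add_right)
    ultimately have i: "inner E T1 + inner E T2 \<ge> e\<^sup>2 + f\<^sup>2 - k\<^sup>2 / 2 - N\<^sup>2 / 100"
      using crossT by linarith
    have "c * inner E T1 - 7/100 * (c * (N * e)) \<le> a * inner G H1"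
      unfolding H1 e_def using R1 unfolding e_def by (rule step[OF lows(1,2) _ a'])
    moreover have "c * inner E T2 - 7/100 * (c * (N * f)) \<le> b * inner G H2"
      unfolding H2 f_def using R2 unfolding f_def by (rule step[OF lows(3,4) _ b'])
    moreover have "c * (N * e) + c * (N * f) = c * N\<^sup>2" unfolding N_def by (simp add: algebra_simps power2_eq_square)
    ultimately have "c * (inner E T1 + inner E T2) - 7/100 * (c * N\<^sup>2) \<le> a * inner G H1 + b * inner G H2"
      by (simp add: algebra_simps)
    moreover have "c * (84/100 * (e\<^sup>2 + f\<^sup>2) - k\<^sup>2 / 2) \<le> c * (inner E T1 + inner E T2 - 7/100 * N\<^sup>2)"
    proof (rule mult_left_mono)
      show "84/100 * (e\<^sup>2 + f\<^sup>2) - k\<^sup>2 / 2 \<le> inner E T1 + inner E T2 - 7/100 * N\<^sup>2" using i N2 by argo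
    qed (use c0 in simp)
    moreover have "c * (inner E T1 + inner E T2 - 7/100 * N\<^sup>2) = c * (inner E T1 + inner E T2) - 7/100 * (c * N\<^sup>2)"
      by (simp add: algebra_simps)
    ultimately show ?thesis by linarith
  qed
  have cu: "c * u\<^sup>2 = eta" unfolding c_def using u0 by simp
  \<comment> \<open>Of the two factors c, one combines with u^2 from the norm bound to
    \<open>eta\<close>, so the quadratic term is smaller than the linear one by a factor of order
    \<open>eta\<close>. The constant 66 exceeds 64 * (201/200)^2.\<close>
  have sq: "g\<^sup>2 * (norm M)\<^sup>2 \<le> 66 * (eta * (c * N\<^sup>2))"
    if M: "norm M \<le> 8 * u * N" and g: "\<bar>g - c\<bar> \<le> c / 200" for M :: fmat and g
  proof -
    have "\<bar>g\<bar> \<le> 201/200 * c" using g by linarith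
    then have "g\<^sup>2 \<le> (201/200 * c)\<^sup>2" using c0 by (simp add: abs_le_square_iff[symmetric])
    moreover have "(norm M)\<^sup>2 \<le> (8 * u * N)\<^sup>2" using M by (intro power_mono) auto
    ultimately have "g\<^sup>2 * (norm M)\<^sup>2 \<le> (201/200 * c)\<^sup>2 * (8 * u * N)\<^sup>2" by (intro mult_mono) auto
    also have "\<dots> = 201\<^sup>2 / 200\<^sup>2 * 64 * ((c * u\<^sup>2) * (c * N\<^sup>2))" by (simp add: power2_eq_square)
    also have "\<dots> \<le> 66 * (eta * (c * N\<^sup>2))" unfolding cu using eta c0 by (simp add: mult_nonneg_nonneg)
    finally show ?thesis .
  qed
  \<comment> \<open>The norm of an update direction is obtained by duality: its square is the
    pairing of G with a product H of rank at most r, to which \<open>GH\<close> applies. No bound on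
    the norm of G itself is needed.\<close>
  have dual: "norm M \<le> 8 * u * N"
    if "(norm M)\<^sup>2 = inner G H" "low n1 n2 r H" "norm H \<le> 4 * u * norm M" for M H :: fmat
  proof -
    have "N * norm H \<le> N * (4 * u * norm M)" using that(3) nn by (intro mult_left_mono) auto
    then have "norm M * norm M \<le> (8 * u * N) * norm M"
      using GH[OF that(2)] that(1) by (simp add: power2_eq_square algebra_simps)
    then show ?thesis
      using nn u0 by (cases "norm M = 0") (simp, metis less_eq_real_def mult_right_le_imp_le norm_ge_zero)
  qed
  define M1 where "M1 = G * (Y * W)"
  define M2 where "M2 = tr G * (X * W')"
  have Wop: "norm (B + B * O') \<le> 2 * norm B" if "norm O' \<le> l / (200 * u)" for B O' :: fmat
  proof -
    have "norm (B * O') \<le> norm B * 1"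
      using norm_mult_ineq[of B O'] mult_left_mono[of "norm O'" 1 "norm B"] that om1 by simp
    then show ?thesis using norm_triangle_ineq[of B "B * O'"] by simp
  qed
  have dM1: "fdim n1 r M1" unfolding M1_def using dG dY dW by blast
  have dM2: "fdim n2 r M2" unfolding M2_def using dG dX dW by blast
  have M1: "norm M1 \<le> 8 * u * N"
  proof (rule dual)
    show "(norm M1)\<^sup>2 = inner G (M1 * tr (Y * W))"
      unfolding power2_norm_eq_inner M1_def by (simp add: inner_mult_right[of G "Y * W"])
    show "low n1 n2 r (M1 * tr (Y * W))" using dM1 dY dW by (intro lowI) auto
    have "M1 * tr (Y * W) = (M1 + M1 * tr Om) * tr Y"
      unfolding W_def using times_idm[OF dM1] by (simp add: algebra_simps) (simp add: mult.assoc[symmetric])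
    then have "norm (M1 * tr (Y * W)) \<le> 2 * u * norm (M1 + M1 * tr Om)" using opY by metis
    also have "\<dots> \<le> 2 * u * (2 * norm M1)" using Wop[of "tr Om" M1] Om u0 by (intro mult_left_mono) auto
    finally show "norm (M1 * tr (Y * W)) \<le> 4 * u * norm M1" by simp
  qed
  have M2: "norm M2 \<le> 8 * u * N"
  proof (rule dual)
    have "inner M2 M2 = inner (tr G) (M2 * tr (X * W'))"
      unfolding M2_def by (simp add: inner_mult_right[of "tr G" "X * W'"])
    also have "\<dots> = inner (tr (tr G)) (tr (M2 * tr (X * W')))" by (rule inner_tr[symmetric])
    finally show "(norm M2)\<^sup>2 = inner G ((X * W') * tr M2)"
      unfolding power2_norm_eq_inner by simp
    show "low n1 n2 r ((X * W') * tr M2)" using dM2 dX dW by (intro lowI) auto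
    have "(X * W') * tr M2 = X * tr (M2 + M2 * tr Om')"
      unfolding W'_def using idm_times[OF fdim_linear(6)[OF dM2]] by (simp add: algebra_simps)
    then have "norm ((X * W') * tr M2) \<le> 2 * u * norm (tr (M2 + M2 * tr Om'))" using opX by metis
    also have "\<dots> \<le> 2 * u * (2 * norm M2)" using Wop[of "tr Om'" M2] Om u0 unfolding norm_tr by (intro mult_left_mono) auto
    finally show "norm ((X * W') * tr M2) \<le> 4 * u * norm M2" by simp
  qed
  have i1: "inner M1 dx = inner G H1" unfolding M1_def H1_def by (rule inner_mult_right)
  have i2: "inner M2 dy = inner G H2"
  proof -
    have "inner M2 dy = inner (tr G) (dy * tr (X * W'))" unfolding M2_def by (rule inner_mult_right)
    also have "\<dots> = inner (tr (tr G)) (tr (dy * tr (X * W')))" by (rule inner_tr[symmetric])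
    finally show ?thesis unfolding H2_def by simp
  qed
  \<comment> \<open>Here \<open>eta\<close> at most 1/1000 is used: 132 * 2 / 1000 = 264/1000, well
    below the gain 2 * 84/100 of the linear term.\<close>
  have second: "a\<^sup>2 * (norm M1)\<^sup>2 + b\<^sup>2 * (norm M2)\<^sup>2 \<le> c * (264/1000 * (e\<^sup>2 + f\<^sup>2))"
  proof -
    have "a\<^sup>2 * (norm M1)\<^sup>2 + b\<^sup>2 * (norm M2)\<^sup>2 \<le> 132 * (eta * (c * N\<^sup>2))"
      using sq[OF M1 a'] sq[OF M2 b'] by linarith
    also have "\<dots> \<le> 132 * (1/1000 * (c * (2 * (e\<^sup>2 + f\<^sup>2))))"
      using eta c0 N2 by (intro mult_left_mono mult_mono) auto
    also have "\<dots> = c * (264/1000 * (e\<^sup>2 + f\<^sup>2))" by (simp add: field_simps)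
    finally show ?thesis .
  qed
  have ef: "l\<^sup>2 / 2 * (x\<^sup>2 + y\<^sup>2) \<le> e\<^sup>2 + f\<^sup>2"
  proof -
    have "(199/200 * (l * x))\<^sup>2 \<le> e\<^sup>2" "(199/200 * (l * y))\<^sup>2 \<le> f\<^sup>2"
      using loe lof nn l0 by (auto intro!: power_mono)
    moreover have "0 \<le> l\<^sup>2 * x\<^sup>2" "0 \<le> l\<^sup>2 * y\<^sup>2" by auto
    moreover have "(199/200 * (l * x))\<^sup>2 = 39601/40000 * (l\<^sup>2 * x\<^sup>2)" "(199/200 * (l * y))\<^sup>2 = 39601/40000 * (l\<^sup>2 * y\<^sup>2)"
      by (simp_all add: power2_eq_square)
    moreover have "l\<^sup>2 / 2 * (x\<^sup>2 + y\<^sup>2) = 1/2 * (l\<^sup>2 * x\<^sup>2) + 1/2 * (l\<^sup>2 * y\<^sup>2)" by (simp add: algebra_simps)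
    ultimately show ?thesis by linarith
  qed
  have "(norm (dx - a *\<^sub>R M1))\<^sup>2 + (norm (dy - b *\<^sub>R M2))\<^sup>2
      = x\<^sup>2 + y\<^sup>2 - 2 * (a * inner G H1 + b * inner G H2) + (a\<^sup>2 * (norm M1)\<^sup>2 + b\<^sup>2 * (norm M2)\<^sup>2)"
    unfolding norm_sub_scale i1 i2 x_def y_def by simp
  also have "\<dots> \<le> x\<^sup>2 + y\<^sup>2 - 2 * (c * (84/100 * (e\<^sup>2 + f\<^sup>2) - k\<^sup>2 / 2)) + c * (264/1000 * (e\<^sup>2 + f\<^sup>2))"
    by (rule add_mono[OF diff_left_mono[OF mult_left_mono[OF first]] second]) simp
  \<comment> \<open>The net gain is 2 * 84/100 - 264/1000 = 1416/1000. Only its being at least 1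
    matters from here on.\<close>
  also have "\<dots> = x\<^sup>2 + y\<^sup>2 - 1416/1000 * (c * (e\<^sup>2 + f\<^sup>2)) + c * k\<^sup>2" by (simp add: field_simps)
  also have "\<dots> \<le> x\<^sup>2 + y\<^sup>2 - c * (l\<^sup>2 / 2 * (x\<^sup>2 + y\<^sup>2)) + c * k\<^sup>2"
  proof -
    have "c * (l\<^sup>2 / 2 * (x\<^sup>2 + y\<^sup>2)) \<le> c * (e\<^sup>2 + f\<^sup>2)" using ef c0 by (intro mult_left_mono) auto
    moreover have "0 \<le> c * (e\<^sup>2 + f\<^sup>2)" using c0 by simp
    ultimately have "c * (l\<^sup>2 / 2 * (x\<^sup>2 + y\<^sup>2)) \<le> 1416/1000 * (c * (e\<^sup>2 + f\<^sup>2))" by argo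
    then show ?thesis by simp
  qed
  also have "\<dots> = (1 - eta * l\<^sup>2 / (2 * u\<^sup>2)) * (x\<^sup>2 + y\<^sup>2) + c * k\<^sup>2"
    unfolding c_def by (simp add: field_simps)
  finally show ?thesis
    unfolding M1_def M2_def G_def W_def W'_def c_def x_def y_def k_def by (simp add: mult.assoc)
qed

end

section \<open>Embedding of matrices\<close>

lift_definition emb :: "real mat \<Rightarrow> fmat" is
  "\<lambda>M i j. if i < dim_row M \<and> j < dim_col M then M $$ (i, j) else 0"
proof -
  fix M :: "real mat"
  show "\<exists>n. \<forall>i j. (if i < dim_row M \<and> j < dim_col M then M $$ (i, j) else 0) \<noteq> 0 \<longrightarrow> i < n \<and> j < n"
    by (rule exI[of _ "dim_row M + dim_col M"]) (auto split: if_splits)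
qed

lemma ent_emb: "ent (emb M) i j = (if i < dim_row M \<and> j < dim_col M then M $$ (i, j) else 0)"
  by (simp add: emb.rep_eq)

lemma fdim_emb: "M \<in> carrier_mat a b \<Longrightarrow> fdim a b (emb M)"
  by (auto simp: fdim_def ent_emb split: if_splits)

definition unemb :: "nat \<Rightarrow> nat \<Rightarrow> fmat \<Rightarrow> real mat" where
  "unemb a b F = mat a b (\<lambda>(i, j). ent F i j)"

lemma unemb_carrier [simp]: "unemb a b F \<in> carrier_mat a b"
  by (simp add: unemb_def)

lemma emb_unemb: "fdim a b F \<Longrightarrow> emb (unemb a b F) = F"
  by (rule fmat_eqI) (auto simp: ent_emb unemb_def fdimD)

lemma emb_inj: "A \<in> carrier_mat a b \<Longrightarrow> B \<in> carrier_mat a b \<Longrightarrow> emb A = emb B \<Longrightarrow> A = B"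
proof (rule eq_matI)
  fix i j assume "A \<in> carrier_mat a b" "B \<in> carrier_mat a b" "emb A = emb B" "i < dim_row B" "j < dim_col B"
  then show "A $$ (i, j) = B $$ (i, j)"
    using ent_emb[of A i j] ent_emb[of B i j] by simp
qed auto

lemma ent_times_fdim: "fdim a b A \<Longrightarrow> ent (A * B) i j = (\<Sum>k<b. ent A i k * ent B k j)"
proof -
  assume A: "fdim a b A"
  obtain n where n: "bnd n A" using bnd_ex by blast
  have "bnd (n + b) A" using n by (rule bnd_mono) simp
  then have "ent (A * B) i j = (\<Sum>k<n + b. ent A i k * ent B k j)" by (simp add: ent_times)
  also have "\<dots> = (\<Sum>k<b. ent A i k * ent B k j)"
    by (rule sum.mono_neutral_right) (auto simp: fdimD[OF A])
  finally show ?thesis .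
qed

lemma inner_fdim:
  assumes A: "fdim a b A"
  shows "inner A B = (\<Sum>i<a. \<Sum>j<b. ent A i j * ent B i j)"
proof -
  obtain n where n: "bnd n A" using bnd_ex by blast
  have "bnd (n + a + b) A" using n by (rule bnd_mono) simp
  then have "inner A B = (\<Sum>i<n + a + b. \<Sum>j<n + a + b. ent A i j * ent B i j)" by (rule inner_bnd2)
  also have "\<dots> = (\<Sum>i<n + a + b. \<Sum>j<b. ent A i j * ent B i j)"
    by (intro sum.cong refl sum.mono_neutral_right) (auto simp: fdimD[OF A])
  also have "\<dots> = (\<Sum>i<a. \<Sum>j<b. ent A i j * ent B i j)"
    by (rule sum.mono_neutral_right) (auto simp: fdimD[OF A] intro!: sum.neutral)
  finally show ?thesis .
qed

lemma emb_mult: "A \<in> carrier_mat a b \<Longrightarrow> B \<in> carrier_mat b c \<Longrightarrow> emb (A * B) = emb A * emb B"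
proof (rule fmat_eqI)
  fix i j assume A: "A \<in> carrier_mat a b" and B: "B \<in> carrier_mat b c"
  have "ent (emb A * emb B) i j = (\<Sum>k<b. ent (emb A) i k * ent (emb B) k j)"
    by (rule ent_times_fdim[OF fdim_emb[OF A]])
  then show "ent (emb (A * B)) i j = ent (emb A * emb B) i j"
    using A B by (auto simp: ent_emb scalar_prod_def lessThan_atLeast0)
qed

lemma emb_transpose: "emb (transpose_mat A) = tr (emb A)"
  by (rule fmat_eqI) (auto simp: ent_emb)

lemma emb_minus: "A \<in> carrier_mat a b \<Longrightarrow> B \<in> carrier_mat a b \<Longrightarrow> emb (A - B) = emb A - emb B"
  by (rule fmat_eqI) (auto simp: ent_emb)

lemma emb_smult: "emb (c \<cdot>\<^sub>m A) = c *\<^sub>R emb A"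
  by (rule fmat_eqI) (auto simp: ent_emb)

lemma emb_one: "emb (1\<^sub>m r) = idm r"
  by (rule fmat_eqI) (auto simp: ent_emb ent_idm)

lemma norm_emb: "norm (emb M) = frob_norm M"
proof -
  have "fdim (dim_row M) (dim_col M) (emb M)" by (rule fdim_emb) simp
  then show ?thesis
    unfolding norm_eq_sqrt_inner inner_fdim[OF \<open>fdim _ _ _\<close>] frob_norm_def
    by (simp add: ent_emb power2_eq_square)
qed

lemma mat_inner_emb:
  assumes "A \<in> carrier_mat a b" "B \<in> carrier_mat a b"
  shows "mat_inner A B = inner (emb A) (emb B)"
proof -
  have "mat_inner A B = (\<Sum>j<b. \<Sum>i<a. B $$ (i, j) * A $$ (i, j))"
    using assms unfolding mat_inner_def Let_def by (auto simp: scalar_prod_def lessThan_atLeast0)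
  also have "\<dots> = (\<Sum>i<a. \<Sum>j<b. A $$ (i, j) * B $$ (i, j))"
    by (subst sum.swap) (simp add: mult.commute)
  also have "\<dots> = inner (emb A) (emb B)"
    unfolding inner_fdim[OF fdim_emb[OF assms(1)]] using assms by (simp add: ent_emb)
  finally show ?thesis .
qed

lemma emb_msum: "emb (msum a b F m) = (\<Sum>k<m. emb (F k))" if "\<And>k. k < m \<Longrightarrow> F k \<in> carrier_mat a b"
  using that
proof (induction m)
  case 0
  show ?case by (rule fmat_eqI) (auto simp: ent_emb msum_def)
next
  case (Suc m)
  have "emb (msum a b F (Suc m)) = emb (msum a b F m) + emb (F m)"
    using Suc.prems[of m] by (intro fmat_eqI) (auto simp: ent_emb msum_def)
  then show ?case using Suc by simp
qed

text \<open>The type is not complete, so instead of summing a Neumann series the inverse comes from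
  a nonzero determinant: a kernel vector, read as a one-column matrix B, would satisfy B = E B and
  hence have at most half its own norm. The second-order remainder is what the descent argument for
  alignments needs.\<close>

lemma fmat_inverse:
  fixes E :: fmat
  assumes E: "fdim r r E" and small: "norm E \<le> 1 / 2"
  obtains N where "fdim r r N" "(idm r - E) * N = idm r" "N * (idm r - E) = idm r"
    "norm (N - idm r - E) \<le> 2 * (norm E)\<^sup>2"
proof -
  define M where "M = unemb r r (idm r - E)"
  have M: "M \<in> carrier_mat r r" unfolding M_def by simp
  have embM: "emb M = idm r - E" unfolding M_def using E by (intro emb_unemb) auto
  have "det M \<noteq> 0"
  proof
    assume "det M = 0"
    then obtain v where v: "v \<in> carrier_vec r" "v \<noteq> 0\<^sub>v r" "M *\<^sub>v v = 0\<^sub>v r"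
      using det_0_iff_vec_prod_zero_field[OF M] by blast
    define B where "B = mat r 1 (\<lambda>(i, j). v $ i)"
    have B: "B \<in> carrier_mat r 1" by (simp add: B_def)
    have col: "col B 0 = v" using v(1) by (intro eq_vecI) (auto simp: B_def)
    have "M * B = 0\<^sub>m r 1"
    proof (rule eq_matI)
      fix i j assume "i < dim_row (0\<^sub>m r 1 :: real mat)" "j < dim_col (0\<^sub>m r 1 :: real mat)"
      then have ij: "i < r" "j = 0" by auto
      have "(M *\<^sub>v v) $ i = 0" using v(3) ij by simp
      then show "(M * B) $$ (i, j) = (0\<^sub>m r 1 :: real mat) $$ (i, j)"
        using ij M B col by simp
    qed (use M B in auto)
    then have "(idm r - E) * emb B = 0"
      unfolding embM[symmetric] emb_mult[OF M B, symmetric] by (simp add: fmat_eqI ent_emb)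
    then have "emb B = E * emb B"
      using idm_times[OF fdim_emb[OF B]] by (simp add: algebra_simps)
    then have "norm (emb B) \<le> norm E * norm (emb B)" by (metis norm_mult_ineq)
    also have "\<dots> \<le> 1 / 2 * norm (emb B)" using small by (intro mult_right_mono) auto
    finally have "emb B = 0" by simp
    have "v = 0\<^sub>v r"
    proof (rule eq_vecI)
      fix i assume i: "i < dim_vec (0\<^sub>v r :: real vec)"
      have "ent (emb B) i 0 = 0" unfolding \<open>emb B = 0\<close> by simp
      then show "v $ i = (0\<^sub>v r :: real vec) $ i" using i by (simp add: ent_emb B_def)
    qed (use v in auto)
    then show False using v(2) by simp
  qed
  then have "M \<in> Units (ring_mat TYPE(real) r ())" by (rule det_non_zero_imp_unit[OF M])
  then obtain M' where M': "M' \<in> carrier_mat r r" "M' * M = 1\<^sub>m r" "M * M' = 1\<^sub>m r"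
    unfolding Units_def ring_mat_def by auto
  define N where "N = emb M'"
  have N: "fdim r r N" unfolding N_def by (rule fdim_emb[OF M'(1)])
  have N1: "(idm r - E) * N = idm r"
    unfolding N_def embM[symmetric] emb_mult[OF M M'(1), symmetric] M'(3) emb_one ..
  have N2: "N * (idm r - E) = idm r"
    unfolding N_def embM[symmetric] emb_mult[OF M'(1) M, symmetric] M'(2) emb_one ..
  \<comment> \<open>Used twice: once to bound N - I by 2 norm E, and once more, with this bound
    inserted, to gain the second power in the remainder.\<close>
  have eq: "N - idm r = E * (N - idm r) + E"
    using N1 idm_times[OF N] times_idm[OF E] by (simp add: algebra_simps)
  have "norm (N - idm r) \<le> norm (E * (N - idm r)) + norm E" by (metis eq norm_triangle_ineq)
  also have "norm (E * (N - idm r)) \<le> norm E * norm (N - idm r)" by (rule norm_mult_ineq)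
  also have "\<dots> \<le> 1 / 2 * norm (N - idm r)" using small by (intro mult_right_mono) auto
  finally have "norm (N - idm r) \<le> 2 * norm E" by simp
  then have "norm E * norm (N - idm r) \<le> norm E * (2 * norm E)" by (intro mult_left_mono) auto
  moreover have "norm (N - idm r - E) \<le> norm E * norm (N - idm r)"
  proof -
    have "N - idm r - E = E * (N - idm r)" using eq by (simp add: algebra_simps)
    then show ?thesis by (simp add: norm_mult_ineq)
  qed
  ultimately have "norm (N - idm r - E) \<le> 2 * (norm E)\<^sup>2" by (simp add: power2_eq_square)
  then show ?thesis using that N N1 N2 by blast
qed

section \<open>Almost optimal alignments\<close>

definition minv :: "nat \<Rightarrow> fmat \<Rightarrow> fmat \<Rightarrow> bool" where
  "minv r P Q \<longleftrightarrow> fdim r r P \<and> fdim r r Q \<and> P * Q = idm r \<and> Q * P = idm r"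

lemma minv_tr: "minv r P Q \<Longrightarrow> minv r (tr Q) (tr P)"
  unfolding minv_def by (metis fdim_linear(6) tr_idm tr_times)

section \<open>Drift between alignments and of their Gram matrices\<close>

lemma norm_mult_mono:
  fixes A B :: "'a::real_normed_algebra"
  assumes "norm A \<le> x" "norm B \<le> y"
  shows "norm (A * B) \<le> x * y"
  using norm_mult_ineq[of A B] mult_mono[OF assms] norm_ge_zero order_trans assms by (metis (no_types))

text \<open>X P E is the difference of the two alignment errors, so its norm is at most 2 \<delta>.
  Since X P is within l / 200 of \<open>Xs\<close>, the lower bound of \<open>Xs\<close> transfers
  to it and E can be recovered. The lemma serves both factors: for Y it is applied to the transposed
  inverses.\<close>

lemma minv_drift:
  assumes inv: "minv r P Q" "minv r P1 Q1" and dX: "fdim n r X"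
    and lo: "\<And>B. fdim r r B \<Longrightarrow> l * norm B \<le> norm (Xs * B)" and l: "0 < l" "\<delta> \<le> l / 200"
    and near: "norm (X * P - Xs) \<le> \<delta>" "norm (X * P1 - Xs) \<le> \<delta>"
  obtains E where "fdim r r E" "P1 = P * (idm r + E)" "norm E \<le> 4 * \<delta> / l"
proof -
  define E where "E = Q * P1 - idm r"
  have dims: "fdim r r P" "fdim r r Q" "fdim r r P1" using inv unfolding minv_def by auto
  have dE: "fdim r r E" unfolding E_def using dims by auto
  have PE: "P * (idm r + E) = P1"
  proof -
    have "P * (Q * P1) = P1" unfolding mult.assoc[symmetric] using inv idm_times[OF dims(3)] by (simp add: minv_def)
    then show ?thesis unfolding E_def by simp
  qed
  have "X * P * E = (X * P1 - Xs) - (X * P - Xs)"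
    unfolding PE[symmetric] using times_idm[OF dims(1)] by (simp add: algebra_simps)
  then have "norm (X * P * E) \<le> 2 * \<delta>" using norm_triangle_ineq4[of "X * P1 - Xs" "X * P - Xs"] near by simp
  moreover have "norm (Xs * E) \<le> norm (X * P * E) + norm ((X * P - Xs) * E)"
    using norm_triangle_ineq4[of "X * P * E" "(X * P - Xs) * E"] by (simp add: algebra_simps)
  moreover have "norm ((X * P - Xs) * E) \<le> l / 200 * norm E"
    using norm_mult_ineq[of "X * P - Xs" E] mult_right_mono[of "norm (X * P - Xs)" "l / 200" "norm E"] near l by simp
  moreover have "0 \<le> l * norm E" using l by simp
  ultimately have "l * norm E \<le> 4 * \<delta>" using lo[OF dE] by simp
  then have "norm E \<le> 4 * \<delta> / l" using l by (simp add: field_simps)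
  then show ?thesis using that dE PE by blast
qed

text \<open>The increment of P^T P is E + E^T up to products containing E and a further small
  factor. The linear part costs 2 e, and the restrictions to 1/10 keep the rest below another 2
  e.\<close>

lemma gram_drift:
  assumes d: "fdim r r P" "fdim r r E" and P1: "P1 = P * (idm r + E)"
    and om: "norm (tr P * P - idm r) \<le> w" "w \<le> 1/10" and e: "norm E \<le> e" "e \<le> 1/10"
  shows "norm (tr P1 * P1 - idm r) \<le> w + 4 * e"
proof -
  define O' where "O' = tr P * P - idm r"
  have dO: "fdim r r O'" unfolding O'_def using d by auto
  have J: "tr P * P = idm r + O'" unfolding O'_def by simp
  have t: "idm r * E = E" "tr E * idm r = tr E" "O' * idm r = O'" "idm r * O' = O'"
    using idm_times[OF d(2)] times_idm[OF fdim_linear(6)[OF d(2)]] times_idm[OF dO] idm_times[OF dO] by auto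
  have JJ: "idm r * idm r = idm r" by (rule times_idm) auto
  have "tr P1 * P1 = (idm r + tr E) * (tr P * P) * (idm r + E)"
    unfolding P1 by (simp add: mult.assoc)
  also have "\<dots> = idm r + O' + (E + tr E + tr E * E + O' * E + tr E * O' + tr E * (O' * E))"
    unfolding J by (simp add: distrib_left distrib_right mult.assoc t JJ)
  finally have eq: "tr P1 * P1 - idm r = O' + (E + tr E + tr E * E + O' * E + tr E * O' + tr E * (O' * E))"
    by simp
  have w0: "0 \<le> w" "0 \<le> e" using om e norm_ge_zero by (metis order_trans)+
  have nO: "norm O' \<le> w" using om unfolding O'_def by simp
  have nE: "norm (tr E) \<le> e" using e by simp
  have "norm (E + tr E + tr E * E + O' * E + tr E * O' + tr E * (O' * E)) \<le> e + e + e * e + w * e + e * w + e * (w * e)"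
    by (intro norm_triangle_mono norm_mult_mono nE e(1) nO)
  then have "norm (tr P1 * P1 - idm r) \<le> w + (e + e + e * e + w * e + e * w + e * (w * e))"
    unfolding eq by (rule norm_triangle_mono[OF nO])
  also have "\<dots> \<le> w + 4 * e"
  proof -
    have "e * e \<le> e * (1/10)" by (rule mult_left_mono) (use e w0 in auto)
    moreover have "w * e \<le> 1/10 * e" by (rule mult_right_mono) (use om w0 in auto)
    moreover have "e * (w * e) \<le> e * (1/10 * (1/10))"
      by (intro mult_left_mono mult_mono) (use om e w0 in auto)
    ultimately show ?thesis using w0 by (simp add: mult.commute)
  qed
  finally show ?thesis .
qed

section \<open>Near-minimizers of the alignment loss\<close>

context ground_truth
begin

definition loss :: "fmat \<Rightarrow> fmat \<Rightarrow> fmat \<Rightarrow> fmat \<Rightarrow> real" where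
  "loss X Y P Q = (norm (X * P - Xs))\<^sup>2 + (norm (Y * tr Q - Ys))\<^sup>2"

definition fdist :: "fmat \<Rightarrow> fmat \<Rightarrow> real" where
  "fdist X Y = Inf {sqrt (loss X Y P Q) | P Q. minv r P Q}"

text \<open>
  Up to a factor, the gradient of the loss in the direction P (I - h K), Q (I - h K)^-1; it vanishes at an
  optimal alignment.
\<close>

definition stat :: "fmat \<Rightarrow> fmat \<Rightarrow> fmat \<Rightarrow> fmat \<Rightarrow> fmat" where
  "stat X Y P Q = tr (X * P) * (X * P - Xs) - tr (Y * tr Q - Ys) * (Y * tr Q)"

lemma loss_nonneg: "0 \<le> loss X Y P Q" unfolding loss_def by simp

lemma fdist_le: "minv r P Q \<Longrightarrow> fdist X Y \<le> sqrt (loss X Y P Q)"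
  unfolding fdist_def by (rule cInf_lower) (auto intro!: bdd_belowI[of _ 0] loss_nonneg)

lemma minv_idm: "minv r (idm r) (idm r)"
  unfolding minv_def using times_idm[of r r "idm r"] by auto

lemma fdist_nonneg: "0 \<le> fdist X Y"
  unfolding fdist_def by (rule cInf_greatest) (use minv_idm in \<open>auto intro: loss_nonneg\<close>)

lemma fdist_sq_le: "minv r P Q \<Longrightarrow> (fdist X Y)\<^sup>2 \<le> loss X Y P Q"
  using power_mono[OF fdist_le fdist_nonneg, of P Q X Y 2] loss_nonneg by simp

lemma fdist_approx:
  assumes "0 < \<epsilon>"
  obtains P Q where "minv r P Q" "loss X Y P Q \<le> (fdist X Y)\<^sup>2 + \<epsilon>"
proof -
  let ?d = "fdist X Y"
  \<comment> \<open>With d the distance, (d + e)^2 exceeds d^2 by e (2 d + e), at most e (2 d + 1)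
    once e is at most 1.\<close>
  define e where "e = min 1 (\<epsilon> / (2 * ?d + 1))"
  have p: "0 < 2 * ?d + 1" using fdist_nonneg[of X Y] by linarith
  have e: "0 < e" "e \<le> 1" "e * (2 * ?d + 1) \<le> \<epsilon>"
  proof -
    have "e * (2 * ?d + 1) \<le> \<epsilon> / (2 * ?d + 1) * (2 * ?d + 1)"
      unfolding e_def using p by (intro mult_right_mono) auto
    then show "e * (2 * ?d + 1) \<le> \<epsilon>" using p by simp
  qed (use assms p in \<open>auto simp: e_def\<close>)
  have "Inf {sqrt (loss X Y P Q) | P Q. minv r P Q} < ?d + e"
    using e unfolding fdist_def by simp
  then obtain P Q where PQ: "minv r P Q" "sqrt (loss X Y P Q) < ?d + e"
    using cInf_lessD[of "{sqrt (loss X Y P Q) | P Q. minv r P Q}"] minv_idm by blast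
  then have "(sqrt (loss X Y P Q))\<^sup>2 \<le> (?d + e)\<^sup>2"
    by (intro power_mono) (auto simp: loss_nonneg)
  also have "\<dots> = ?d\<^sup>2 + e * (2 * ?d + e)" by (simp add: power2_eq_square algebra_simps)
  also have "\<dots> \<le> ?d\<^sup>2 + e * (2 * ?d + 1)" using e by (intro add_left_mono mult_left_mono) auto
  finally have "loss X Y P Q \<le> ?d\<^sup>2 + \<epsilon>" using e(3) loss_nonneg by simp
  then show ?thesis using that PQ by blast
qed

text \<open>P moves to P (I - h K), and the inverse to (I + h K + T) Q with a second-order remainder
  T. The first-order change of the loss is -2 h k^2, and everything else is bounded by 9 M^2 h^2
  k^2.\<close>

lemma alignment_descent:
  assumes inv: "minv r P Q" and dX: "fdim n1 r X" and dY: "fdim n2 r Y"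
    and m: "loss X Y P Q \<le> m\<^sup>2" "0 \<le> m"
    and M: "1 \<le> M" "norm Xs + m \<le> M" "norm Ys + m \<le> M"
  obtains P' Q' where "minv r P' Q'"
    "loss X Y P' Q' \<le> loss X Y P Q - (norm (stat X Y P Q))\<^sup>2 / (9 * M\<^sup>2)"
proof -
  define K where "K = stat X Y P Q"
  define Xh where "Xh = X * P"
  define Yh where "Yh = Y * tr Q"
  define dx where "dx = Xh - Xs"
  define dy where "dy = Yh - Ys"
  \<comment> \<open>This h minimizes -2 h + 9 M^2 h^2. The 9 collects 1 from the X part, 4 from the
    remainder T paired with \<open>dy\<close>, and 4 from the square of the Y displacement.\<close>
  define h where "h = 1 / (9 * M\<^sup>2)"
  define k where "k = norm K"
  have h0: "0 < h" unfolding h_def using M by simp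
  have hM: "9 * M\<^sup>2 * h = 1" unfolding h_def using M by simp
  have k0: "0 \<le> k" unfolding k_def by simp
  have dP: "fdim r r P" "fdim r r Q" using inv unfolding minv_def by auto
  have dXh: "fdim n1 r Xh" "fdim n2 r Yh" unfolding Xh_def Yh_def using dX dY dP by blast+
  have ddx: "fdim n1 r dx" "fdim n2 r dy" unfolding dx_def dy_def using dXh dXs dYs by blast+
  have Kdef: "K = tr Xh * dx - tr dy * Yh" unfolding K_def stat_def Xh_def Yh_def dx_def dy_def ..
  have dK: "fdim r r K" unfolding Kdef using dXh ddx by blast
  have L: "loss X Y P Q = (norm dx)\<^sup>2 + (norm dy)\<^sup>2" unfolding loss_def dx_def dy_def Xh_def Yh_def ..
  have "(norm dx)\<^sup>2 \<le> m\<^sup>2" "(norm dy)\<^sup>2 \<le> m\<^sup>2"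
    using m L zero_le_power2[of "norm dx"] zero_le_power2[of "norm dy"] by linarith+
  then have ndx: "norm dx \<le> m" "norm dy \<le> m"
    using m(2) by (auto intro: power2_le_imp_le)
  have m_M: "m \<le> M" using M norm_ge_zero[of Xs] by linarith
  have nXh: "norm Xh \<le> M"
    using ndx(1) M norm_triangle_ineq[of Xs dx] unfolding dx_def by simp
  have nYh: "norm Yh \<le> M"
    using ndx(2) M norm_triangle_ineq[of Ys dy] unfolding dy_def by simp
  \<comment> \<open>This crude bound makes h k at most 1/2, so that I - h K is invertible by
    \<open>fmat_inverse\<close>.\<close>
  have "k \<le> 2 * M\<^sup>2"
  proof -
    have "norm (tr Xh * dx) \<le> M * M" by (rule norm_mult_mono) (use nXh ndx m_M in auto)
    moreover have "norm (tr dy * Yh) \<le> M * M" by (rule norm_mult_mono) (use nYh ndx m_M in auto)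
    ultimately show ?thesis unfolding k_def Kdef power2_eq_square
      using norm_triangle_ineq4[of "tr Xh * dx" "tr dy * Yh"] by linarith
  qed
  then have "h * k \<le> h * (2 * M\<^sup>2)" using h0 by (intro mult_left_mono) auto
  then have hk: "h * k \<le> 1 / 2" using hM by (simp add: algebra_simps)
  have nhK: "norm (h *\<^sub>R K) = h * k" unfolding k_def using h0 by simp
  obtain N where N: "fdim r r N" "(idm r - h *\<^sub>R K) * N = idm r" "N * (idm r - h *\<^sub>R K) = idm r"
    "norm (N - idm r - h *\<^sub>R K) \<le> 2 * (norm (h *\<^sub>R K))\<^sup>2"
    using fmat_inverse[of r "h *\<^sub>R K"] dK hk nhK by (metis fdim_linear(5))
  define T where "T = N - idm r - h *\<^sub>R K"
  have nT: "norm T \<le> 2 * (h * k)\<^sup>2" using N(4) nhK unfolding T_def by simp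
  have NT: "N = idm r + h *\<^sub>R K + T" unfolding T_def by simp
  define P' where "P' = P * (idm r - h *\<^sub>R K)"
  define Q' where "Q' = N * Q"
  have inv': "minv r P' Q'"
  proof -
    have "P' * Q' = P * ((idm r - h *\<^sub>R K) * N) * Q" unfolding P'_def Q'_def by (simp add: mult.assoc)
    then have 1: "P' * Q' = idm r" unfolding N(2) using times_idm[OF dP(1)] inv by (simp add: minv_def)
    have "Q' * P' = N * (Q * P) * (idm r - h *\<^sub>R K)" unfolding P'_def Q'_def by (simp add: mult.assoc)
    then have 2: "Q' * P' = idm r" using times_idm[OF N(1)] inv N(3) by (simp add: minv_def)
    have "fdim r r P'" "fdim r r Q'" unfolding P'_def Q'_def using dP dK N(1) by blast+
    then show ?thesis unfolding minv_def using 1 2 by blast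
  qed
  define S where "S = Yh * (h *\<^sub>R tr K + tr T)"
  have X': "X * P' - Xs = dx - h *\<^sub>R (Xh * K)"
    unfolding P'_def dx_def Xh_def mult.assoc[symmetric]
    using times_idm[OF dXh(1)[unfolded Xh_def]] by (simp add: right_diff_distrib)
  have Y': "Y * tr Q' - Ys = dy - (-1) *\<^sub>R S"
  proof -
    have "Y * tr Q' = Yh * tr N" unfolding Q'_def Yh_def by (simp add: mult.assoc)
    also have "\<dots> = Yh + S" unfolding NT S_def using times_idm[OF dXh(2)] by (simp add: algebra_simps)
    finally show ?thesis unfolding dy_def by simp
  qed
  have iX: "inner (Xh * K) dx = inner K (tr Xh * dx)" by (rule inner_mult_left)
  have iY: "inner S dy = h * inner K (tr dy * Yh) + inner (Yh * tr T) dy"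
  proof -
    have "inner (Yh * tr K) dy = inner (tr K) (tr (tr dy * Yh))" by (simp add: inner_mult_left)
    then have "inner (Yh * tr K) dy = inner K (tr dy * Yh)" by (simp only: inner_tr)
    then show ?thesis unfolding S_def by (simp add: distrib_left inner_add_left)
  qed
  have bT: "\<bar>inner (Yh * tr T) dy\<bar> \<le> 2 * M\<^sup>2 * (h * k)\<^sup>2"
  proof -
    have "norm (Yh * tr T) \<le> M * (2 * (h * k)\<^sup>2)" by (rule norm_mult_mono) (use nYh nT in auto)
    moreover have "norm dy \<le> M" using ndx m_M by linarith
    ultimately have "norm (Yh * tr T) * norm dy \<le> M * (2 * (h * k)\<^sup>2) * M"
      using M by (intro mult_mono) auto
    then show ?thesis using Cauchy_Schwarz_ineq2[of "Yh * tr T" dy] by (simp add: power2_eq_square algebra_simps)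
  qed
  have bS: "(norm S)\<^sup>2 \<le> 4 * M\<^sup>2 * (h * k)\<^sup>2"
  proof -
    have "2 * (h * k)\<^sup>2 \<le> h * k"
      using mult_left_mono[OF hk, of "h * k"] h0 k0 by (simp add: power2_eq_square)
    then have "norm (h *\<^sub>R tr K + tr T) \<le> 2 * (h * k)"
      using norm_triangle_ineq[of "h *\<^sub>R tr K" "tr T"] nT h0 unfolding k_def by simp
    then have "norm S \<le> M * (2 * (h * k))" unfolding S_def by (intro norm_mult_mono nYh)
    then have "(norm S)\<^sup>2 \<le> (M * (2 * (h * k)))\<^sup>2" by (intro power_mono) auto
    then show ?thesis by (simp add: power_mult_distrib)
  qed
  have bX: "(norm (Xh * K))\<^sup>2 \<le> M\<^sup>2 * k\<^sup>2"
  proof -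
    have "norm (Xh * K) \<le> M * k" by (rule norm_mult_mono) (use nXh k_def in auto)
    then have "(norm (Xh * K))\<^sup>2 \<le> (M * k)\<^sup>2" by (intro power_mono) auto
    then show ?thesis by (simp add: power_mult_distrib)
  qed
  have bX': "h\<^sup>2 * (norm (Xh * K))\<^sup>2 \<le> M\<^sup>2 * (h * k)\<^sup>2"
    using mult_left_mono[OF bX, of "h\<^sup>2"] by (simp add: power_mult_distrib mult_ac)
  \<comment> \<open>The first-order terms of both factors pair K with the two halves of its own
    definition, so they combine to its squared norm.\<close>
  have kk: "inner K (tr Xh * dx) - inner K (tr dy * Yh) = k\<^sup>2"
    unfolding k_def power2_norm_eq_inner by (subst (4) Kdef) (simp add: inner_diff_right)
  have "loss X Y P' Q' = (norm dx)\<^sup>2 + (norm dy)\<^sup>2 - 2 * h * (inner K (tr Xh * dx) - inner K (tr dy * Yh))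
      + h\<^sup>2 * (norm (Xh * K))\<^sup>2 + 2 * inner (Yh * tr T) dy + (norm S)\<^sup>2"
    unfolding loss_def X' Y' norm_sub_scale iX iY by (simp add: algebra_simps)
  also have "\<dots> = loss X Y P Q - 2 * (h * k\<^sup>2) + h\<^sup>2 * (norm (Xh * K))\<^sup>2 + 2 * inner (Yh * tr T) dy + (norm S)\<^sup>2"
    unfolding kk L by simp
  also have "\<dots> \<le> loss X Y P Q - 2 * (h * k\<^sup>2) + 9 * (M\<^sup>2 * (h * k)\<^sup>2)"
    using bX' bT bS by (simp add: abs_le_iff)
  also have "9 * (M\<^sup>2 * (h * k)\<^sup>2) = (9 * M\<^sup>2 * h) * (h * k\<^sup>2)" by (simp add: power2_eq_square)
  finally have "loss X Y P' Q' \<le> loss X Y P Q - h * k\<^sup>2" unfolding hM by simp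
  then show ?thesis using that inv' unfolding h_def k_def K_def by simp
qed

text \<open>An alignment within e' of the infimum cannot be improved by more than e', so the
  guaranteed decrease in \<open>alignment_descent\<close> is at most e'. This substitutes for the
  first-order condition at a minimizer whose existence is never established.\<close>

lemma near_stationary:
  assumes dX: "fdim n1 r X" and dY: "fdim n2 r Y" and e: "0 < \<epsilon>"
  obtains P Q where "minv r P Q" "loss X Y P Q \<le> (fdist X Y)\<^sup>2 + \<epsilon>" "(norm (stat X Y P Q))\<^sup>2 \<le> \<epsilon>"
proof -
  let ?d = "fdist X Y"
  \<comment> \<open>The constants m and M must be fixed before e', because e' is defined through M.
    Capping e' at 1 makes m valid for every alignment that may be picked.\<close>
  define m where "m = sqrt (?d\<^sup>2 + 1)"
  define M where "M = 1 + norm Xs + norm Ys + m"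
  have m0: "0 \<le> m" "m\<^sup>2 = ?d\<^sup>2 + 1" unfolding m_def by auto
  have M: "1 \<le> M" "norm Xs + m \<le> M" "norm Ys + m \<le> M" unfolding M_def using m0 by auto
  have M2: "1 \<le> 9 * M\<^sup>2" using one_le_power[OF M(1), of 2] by simp
  define e' where "e' = min 1 (\<epsilon> / (9 * M\<^sup>2))"
  have e': "0 < e'" "e' \<le> 1" "9 * M\<^sup>2 * e' \<le> \<epsilon>"
  proof -
    have "9 * M\<^sup>2 * e' \<le> 9 * M\<^sup>2 * (\<epsilon> / (9 * M\<^sup>2))"
      unfolding e'_def using M2 by (intro mult_left_mono) auto
    then show "9 * M\<^sup>2 * e' \<le> \<epsilon>" using M by simp
    show "0 < e'" unfolding e'_def using e M by simp
  qed (simp add: e'_def)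
  have "1 * e' \<le> 9 * M\<^sup>2 * e'" by (rule mult_right_mono[OF M2]) (use e' in simp)
  then have "e' \<le> \<epsilon>" using e'(3) by linarith
  obtain P Q where PQ: "minv r P Q" "loss X Y P Q \<le> ?d\<^sup>2 + e'" using fdist_approx[OF e'(1)] .
  have "loss X Y P Q \<le> m\<^sup>2" using PQ e' m0 by simp
  then obtain P' Q' where P': "minv r P' Q'" "loss X Y P' Q' \<le> loss X Y P Q - (norm (stat X Y P Q))\<^sup>2 / (9 * M\<^sup>2)"
    using alignment_descent[OF PQ(1) dX dY _ m0(1) M] by blast
  then have "(norm (stat X Y P Q))\<^sup>2 / (9 * M\<^sup>2) \<le> e'" using fdist_sq_le[OF P'(1), of X Y] PQ by linarith
  moreover have "0 < 9 * M\<^sup>2" using M2 by linarith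
  ultimately have "(norm (stat X Y P Q))\<^sup>2 \<le> 9 * M\<^sup>2 * e'" by (simp only: pos_divide_le_eq mult.commute)
  then have "(norm (stat X Y P Q))\<^sup>2 \<le> \<epsilon>" using e' by linarith
  then show ?thesis using that PQ \<open>e' \<le> \<epsilon>\<close> by force
qed

end

section \<open>Convergence\<close>

context ground_truth
begin

text \<open>Both iterates are measured in the same alignment. The product X Y^T and hence the
  gradient matrix are unchanged by it, while Y P = (Y Q^T) P^T P and X Q^T = (X P) Q Q^T bring in
  the Gram matrices, so \<open>one_step\<close> applies.\<close>

lemma gd_step:
  fixes X Y P Q :: fmat
  assumes inv: "minv r P Q"
    and rip: "\<And>H1 H2. low n1 n2 r H1 \<Longrightarrow> low n1 n2 r H2 \<Longrightarrow>
      \<bar>(\<Sum>i<m. inner (A i) H1 * inner (A i) H2) - inner H1 H2\<bar> \<le> 1/200 * norm H1 * norm H2"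
    and dA: "\<And>i. i < m \<Longrightarrow> fdim n1 n2 (A i)"
    and dX: "fdim n1 r X" and dY: "fdim n2 r Y"
    and gram: "norm (tr P * P - idm r) \<le> l / (200 * u)" "norm (Q * tr Q - idm r) \<le> l / (200 * u)"
    and small: "loss X Y P Q \<le> (l / 200)\<^sup>2"
    and eta: "0 < eta" "eta \<le> 1/1000"
    and a: "\<bar>a - eta / u\<^sup>2\<bar> \<le> eta / u\<^sup>2 / 200" and b: "\<bar>b - eta / u\<^sup>2\<bar> \<le> eta / u\<^sup>2 / 200"
  shows "loss (X - a *\<^sub>R (grad A m X Y * Y)) (Y - b *\<^sub>R (tr (grad A m X Y) * X)) P Q
     \<le> (1 - eta * l\<^sup>2 / (2 * u\<^sup>2)) * loss X Y P Q + eta / u\<^sup>2 * (norm (stat X Y P Q))\<^sup>2"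
proof -
  define Xh where "Xh = X * P"
  define Yh where "Yh = Y * tr Q"
  have dP: "fdim r r P" "fdim r r Q" and PQ: "P * Q = idm r" "Q * P = idm r" using inv unfolding minv_def by auto
  have d: "fdim n1 r Xh" "fdim n2 r Yh" unfolding Xh_def Yh_def using dX dY dP by blast+
  have XQ: "Xh * Q = X" unfolding Xh_def mult.assoc PQ by (rule times_idm[OF dX])
  have YP: "Yh * tr P = Y" unfolding Yh_def mult.assoc tr_times[symmetric] PQ tr_idm by (rule times_idm[OF dY])
  have XY: "Xh * tr Yh = X * tr Y"
    unfolding Yh_def tr_times tr_linear mult.assoc[symmetric] XQ ..
  have G: "grad A m Xh Yh = grad A m X Y" unfolding grad_def XY ..
  have L: "loss X Y P Q = (norm (Xh - Xs))\<^sup>2 + (norm (Yh - Ys))\<^sup>2" unfolding loss_def Xh_def Yh_def ..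
  have "(norm (Xh - Xs))\<^sup>2 \<le> (l / 200)\<^sup>2" "(norm (Yh - Ys))\<^sup>2 \<le> (l / 200)\<^sup>2"
    using small L zero_le_power2[of "norm (Xh - Xs)"] zero_le_power2[of "norm (Yh - Ys)"] by linarith+
  then have sm: "norm (Xh - Xs) \<le> l / 200" "norm (Yh - Ys) \<le> l / 200"
    using l0 by (auto intro: power2_le_imp_le)
  have dOm: "fdim r r (tr P * P - idm r)" "fdim r r (Q * tr Q - idm r)" using dP by auto
  have gY: "G * Y * P = G * (Yh * (tr P * P))" for G
  proof -
    have "G * (Yh * (tr P * P)) = G * (Yh * tr P) * P" by (simp only: mult.assoc)
    then show ?thesis unfolding YP ..
  qed
  have gX: "G * X * tr Q = G * (Xh * (Q * tr Q))" for G
  proof -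
    have "G * (Xh * (Q * tr Q)) = G * (Xh * Q) * tr Q" by (simp only: mult.assoc)
    then show ?thesis unfolding XQ ..
  qed
  have X': "(X - a *\<^sub>R (grad A m X Y * Y)) * P - Xs
      = Xh - Xs - a *\<^sub>R (grad A m Xh Yh * (Yh * (idm r + (tr P * P - idm r))))"
    unfolding G by (simp add: left_diff_distrib Xh_def[symmetric] gY)
  have Y': "(Y - b *\<^sub>R (tr (grad A m X Y) * X)) * tr Q - Ys
      = Yh - Ys - b *\<^sub>R (tr (grad A m Xh Yh) * (Xh * (idm r + (Q * tr Q - idm r))))"
    unfolding G by (simp add: left_diff_distrib Yh_def[symmetric] gX)
  have S: "stat X Y P Q = tr Xh * (Xh - Xs) - tr (Yh - Ys) * Yh" unfolding stat_def Xh_def Yh_def ..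
  show ?thesis
    unfolding L S loss_def[of "X - _"] X' Y'
    by (rule one_step[OF rip dA d dOm gram sm eta a b])
qed

text \<open>The induction carries the rate for the infimum together with an alignment of loss at
  most (2 \<rho>^t D)^2 and controlled Gram matrices. The factor 2 is the room that allows
  alignments which are only almost optimal. As \<tau>^2 is 1 / \<kappa>, the number 50000 is 50
  times the inverse step size.\<close>

lemma gd_converges:
  fixes X Y :: "nat \<Rightarrow> fmat"
  defines "\<tau> \<equiv> l / u"
  defines "\<rho> \<equiv> 1 - \<tau>\<^sup>2 / 50000"
  assumes rip: "\<And>H1 H2. low n1 n2 r H1 \<Longrightarrow> low n1 n2 r H2 \<Longrightarrow>
      \<bar>(\<Sum>i<m. inner (A i) H1 * inner (A i) H2) - inner H1 H2\<bar> \<le> 1/200 * norm H1 * norm H2"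
    and dA: "\<And>i. i < m \<Longrightarrow> fdim n1 n2 (A i)"
    and dX: "fdim n1 r (X 0)" and dY: "fdim n2 r (Y 0)"
    and X: "\<And>t. X (Suc t) = X t - a *\<^sub>R (grad A m (X t) (Y t) * Y t)"
    and Y: "\<And>t. Y (Suc t) = Y t - b *\<^sub>R (tr (grad A m (X t) (Y t)) * X t)"
    and a: "\<bar>a - 1/1000 / u\<^sup>2\<bar> \<le> 1/1000 / u\<^sup>2 / 200" and b: "\<bar>b - 1/1000 / u\<^sup>2\<bar> \<le> 1/1000 / u\<^sup>2 / 200"
    and D: "D = \<tau> ^ 3 * l / 10 ^ 9"
    and R: "minv r R (tr R)" "loss (X 0) (Y 0) R (tr R) \<le> (2 * D)\<^sup>2"
    and start: "fdist (X 0) (Y 0) \<le> D"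
  shows "fdist (X t) (Y t) \<le> \<rho> ^ t * fdist (X 0) (Y 0)"
proof -
  \<comment> \<open>C is chosen such that C (1 - rho^t) is the sum of the drifts of the Gram matrices before time t (see next_C)\<close>
  define C where "C = 16 / 10 ^ 4 * \<tau>"
  note u0 = u0
  have \<tau>: "0 < \<tau>" "\<tau> \<le> 1" unfolding \<tau>_def using l0 lu u0 by auto
  have \<tau>2: "0 < \<tau>\<^sup>2" "\<tau>\<^sup>2 \<le> 1" using \<tau> by (auto intro: power_le_one)
  have \<tau>3: "0 < \<tau> ^ 3" "\<tau> ^ 3 \<le> 1" using \<tau> by (auto intro: power_le_one)
  have \<rho>: "0 < \<rho>" "\<rho> \<le> 1" unfolding \<rho>_def using \<tau>2 by auto
  have \<rho>t: "0 < \<rho> ^ t" "\<rho> ^ t \<le> 1" for t using \<rho> by (auto intro: power_le_one)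
  have D0: "0 < D" "D \<le> l / 10 ^ 9" unfolding D using \<tau>3 l0 by auto
  have C: "0 < C" "C \<le> \<tau> / 200" unfolding C_def using \<tau> by auto
  have dims: "fdim n1 r (X t)" "fdim n2 r (Y t)" for t
  proof (induction t)
    case (Suc t)
    have dG: "fdim n1 n2 (grad A m (X t) (Y t))"
      unfolding grad_def using dA by (induction m) auto
    show "fdim n1 r (X (Suc t))" "fdim n2 r (Y (Suc t))"
      unfolding X Y using Suc dG by blast+
  qed (use dX dY in auto)
  \<comment> \<open>One step contracts the squared error by 1 - \<tau>^2 / 2000, whereas \<rho>^2 is
    only about 1 - \<tau>^2 / 25000.\<close>
  have rate: "1 - \<tau>\<^sup>2 / 2000 \<le> \<rho>\<^sup>2"
  proof -
    have "\<rho>\<^sup>2 = 1 - 2 * (\<tau>\<^sup>2 / 50000) + (\<tau>\<^sup>2 / 50000)\<^sup>2" unfolding \<rho>_def by (simp add: power2_diff)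
    then show ?thesis using \<tau>2 zero_le_power2[of "\<tau>\<^sup>2 / 50000"] by linarith
  qed
  have "fdist (X t) (Y t) \<le> \<rho> ^ t * fdist (X 0) (Y 0) \<and>
    (\<exists>P Q. minv r P Q \<and> loss (X t) (Y t) P Q \<le> (2 * (\<rho> ^ t * D))\<^sup>2 \<and>
       norm (tr P * P - idm r) \<le> C * (1 - \<rho> ^ t) \<and> norm (Q * tr Q - idm r) \<le> C * (1 - \<rho> ^ t))"
  proof (induction t)
    case 0
    \<comment> \<open>An orthogonal alignment has Gram matrix exactly I, which matches the empty
      drift budget C (1 - \<rho>^0) = 0.\<close>
    have "tr R * R = idm r" using R(1) unfolding minv_def by simp
    then have "minv r R (tr R) \<and> loss (X 0) (Y 0) R (tr R) \<le> (2 * (\<rho> ^ 0 * D))\<^sup>2 \<and>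
       norm (tr R * R - idm r) \<le> C * (1 - \<rho> ^ 0) \<and> norm (tr R * tr (tr R) - idm r) \<le> C * (1 - \<rho> ^ 0)"
      using R by simp
    then show ?case by fastforce
  next
    case (Suc t)
    define d where "d = \<rho> ^ t * D"
    define f where "f = fdist (X t) (Y t)"
    have d0: "0 < d" "d \<le> l / 10 ^ 9"
    proof -
      have "\<rho> ^ t * D \<le> 1 * D" using D0 \<rho>t[of t] by (intro mult_right_mono) auto
      then show "d \<le> l / 10 ^ 9" unfolding d_def using D0 by linarith
      show "0 < d" unfolding d_def using D0 \<rho>t[of t] by simp
    qed
    have f0: "0 \<le> f" unfolding f_def by (rule fdist_nonneg)
    have "f \<le> \<rho> ^ t * fdist (X 0) (Y 0)" unfolding f_def using Suc by simp
    also have "\<dots> \<le> d" unfolding d_def using start \<rho>t[of t] by (intro mult_left_mono) auto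
    finally have fd: "f \<le> d" .
    then have fd2: "f\<^sup>2 \<le> d\<^sup>2" using f0 by (rule power_mono)
    obtain P Q where inv: "minv r P Q" and lP: "loss (X t) (Y t) P Q \<le> (2 * d)\<^sup>2"
      and gP: "norm (tr P * P - idm r) \<le> C * (1 - \<rho> ^ t)" "norm (Q * tr Q - idm r) \<le> C * (1 - \<rho> ^ t)"
      using Suc unfolding d_def by blast
    \<comment> \<open>P1 is chosen almost stationary for the iterate at time t and then kept for
      time t + 1. The statement is used for all small \<epsilon>, which gives the rate, and for one
      fixed \<epsilon>, which gives the alignment for the next round.\<close>
    have main: "\<exists>P1 Q1. minv r P1 Q1 \<and> loss (X (Suc t)) (Y (Suc t)) P1 Q1 \<le> \<rho>\<^sup>2 * f\<^sup>2 + \<epsilon> \<and>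
       norm (tr P1 * P1 - idm r) \<le> C * (1 - \<rho> ^ Suc t) \<and> norm (Q1 * tr Q1 - idm r) \<le> C * (1 - \<rho> ^ Suc t)"
      if e: "0 < \<epsilon>" for \<epsilon>
    proof -
      define c where "c = 1 + 1/1000 / u\<^sup>2"
      have c: "1 \<le> c" unfolding c_def using u0 by simp
      \<comment> \<open>The bound 3 d^2 keeps the loss of P1 below f^2 + 3 d^2, at most (2 d)^2, so
        P1 is comparable with P. Division by c makes the excess of the loss and the stationarity
        residual together cost at most \<epsilon>.\<close>
      define e' where "e' = min (3 * d\<^sup>2) (\<epsilon> / c)"
      have e': "0 < e'" "e' \<le> 3 * d\<^sup>2" unfolding e'_def using e d0 c by auto
      have "c * e' \<le> c * (\<epsilon> / c)" unfolding e'_def using c by (intro mult_left_mono) auto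
      then have ce': "c * e' \<le> \<epsilon>" using c by simp
      obtain P1 Q1 where inv1: "minv r P1 Q1" and l1: "loss (X t) (Y t) P1 Q1 \<le> f\<^sup>2 + e'"
        and s1: "(norm (stat (X t) (Y t) P1 Q1))\<^sup>2 \<le> e'"
        using near_stationary[OF dims e'(1)] unfolding f_def by blast
      have lP1: "loss (X t) (Y t) P1 Q1 \<le> (2 * d)\<^sup>2"
        using l1 e' fd2 by (simp add: power_mult_distrib)
      have near: "norm (X t * P - Xs) \<le> 2 * d" "norm (Y t * tr Q - Ys) \<le> 2 * d"
        if "loss (X t) (Y t) P Q \<le> (2 * d)\<^sup>2" for P Q
      proof -
        have "(norm (X t * P - Xs))\<^sup>2 \<le> (2 * d)\<^sup>2" "(norm (Y t * tr Q - Ys))\<^sup>2 \<le> (2 * d)\<^sup>2"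
          using that zero_le_power2[of "norm (X t * P - Xs)"] zero_le_power2[of "norm (Y t * tr Q - Ys)"]
          unfolding loss_def by linarith+
        then show "norm (X t * P - Xs) \<le> 2 * d" "norm (Y t * tr Q - Ys) \<le> 2 * d"
          using d0 by (auto intro: power2_le_imp_le)
      qed
      define h where "h = 8 * d / l"
      have hD: "h = 8 * \<tau> ^ 3 / 10 ^ 9 * \<rho> ^ t" unfolding h_def d_def D using l0 by simp
      have h10: "h \<le> 1/10" unfolding h_def using d0 l0 by (simp add: field_simps)
      have dl: "2 * d \<le> l / 200" using d0 l0 by simp
      have Ct: "C * (1 - \<rho> ^ t) \<le> C" for t using C \<rho>t[of t] by simp
      have C10: "C * (1 - \<rho> ^ t) \<le> 1/10" using Ct[of t] C \<tau> by linarith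
      \<comment> \<open>The drift 4 h of this step equals C \<rho>^t (1 - \<rho>), so the budgets
        telescope. The factor \<tau>^3 in D over \<tau>^2 in 1 - \<rho> leaves C proportional to
        \<tau>, the tolerance of \<open>one_step\<close>.\<close>
      have next_C: "C * (1 - \<rho> ^ t) + 4 * h = C * (1 - \<rho> ^ Suc t)"
        unfolding hD C_def \<rho>_def by (simp add: algebra_simps power2_eq_square power3_eq_cube)
      obtain E where E: "fdim r r E" "P1 = P * (idm r + E)" "norm E \<le> 4 * (2 * d) / l"
        using minv_drift[OF inv inv1 dims(1) loX l0 dl near(1)[OF lP] near(1)[OF lP1]] .
      \<comment> \<open>The second Gram matrix Q Q^T is that of the transposed inverse, which is
        also the matrix aligning Y. Its drift is estimated separately, from Y and
        \<open>Ys\<close>.\<close>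
      obtain E' where E': "fdim r r E'" "tr Q1 = tr Q * (idm r + E')" "norm E' \<le> 4 * (2 * d) / l"
        using minv_drift[OF minv_tr[OF inv] minv_tr[OF inv1] dims(2) loY l0 dl near(2)[OF lP] near(2)[OF lP1]] .
      have dP: "fdim r r P" "fdim r r Q" using inv unfolding minv_def by auto
      have nE: "norm E \<le> h" and nE': "norm E' \<le> h" using E(3) E'(3) unfolding h_def by auto
      have g1: "norm (tr P1 * P1 - idm r) \<le> C * (1 - \<rho> ^ Suc t)"
        by (rule gram_drift[OF dP(1) E(1,2) gP(1) C10 nE h10, unfolded next_C])
      have "norm (tr (tr Q) * tr Q - idm r) \<le> C * (1 - \<rho> ^ t)" using gP(2) by simp
      then have "norm (tr (tr Q1) * tr Q1 - idm r) \<le> C * (1 - \<rho> ^ Suc t)"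
        by (rule gram_drift[OF fdim_linear(6)[OF dP(2)] E'(1,2) _ C10 nE' h10, unfolded next_C])
      then have g2: "norm (Q1 * tr Q1 - idm r) \<le> C * (1 - \<rho> ^ Suc t)" by simp
      have Clu: "C * (1 - \<rho> ^ Suc t) \<le> l / (200 * u)"
      proof -
        have "\<tau> / 200 = l / (200 * u)" unfolding \<tau>_def by simp
        then show ?thesis using Ct[of "Suc t"] C(2) by linarith
      qed
      have "loss (X t) (Y t) P1 Q1 \<le> (l / 200)\<^sup>2"
        using lP1 power_mono[OF dl, of 2] d0 by simp
      then have st: "loss (X (Suc t)) (Y (Suc t)) P1 Q1
          \<le> (1 - 1/1000 * l\<^sup>2 / (2 * u\<^sup>2)) * loss (X t) (Y t) P1 Q1 + 1/1000 / u\<^sup>2 * (norm (stat (X t) (Y t) P1 Q1))\<^sup>2"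
        unfolding X Y using g1 g2 Clu
        by (intro gd_step[OF inv1 rip dA dims _ _ _ _ _ a b]) auto
      have eq: "1 - 1/1000 * l\<^sup>2 / (2 * u\<^sup>2) = 1 - \<tau>\<^sup>2 / 2000" unfolding \<tau>_def by (simp add: power_divide)
      have "loss (X (Suc t)) (Y (Suc t)) P1 Q1 \<le> \<rho>\<^sup>2 * (f\<^sup>2 + e') + 1/1000 / u\<^sup>2 * e'"
      proof (rule order_trans[OF st add_mono])
        show "(1 - 1/1000 * l\<^sup>2 / (2 * u\<^sup>2)) * loss (X t) (Y t) P1 Q1 \<le> \<rho>\<^sup>2 * (f\<^sup>2 + e')"
          unfolding eq using rate l1 loss_nonneg by (intro mult_mono) auto
        show "1/1000 / u\<^sup>2 * (norm (stat (X t) (Y t) P1 Q1))\<^sup>2 \<le> 1/1000 / u\<^sup>2 * e'"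
          using s1 by (intro mult_left_mono) auto
      qed
      also have "\<dots> \<le> \<rho>\<^sup>2 * f\<^sup>2 + c * e'"
      proof -
        have "\<rho>\<^sup>2 \<le> 1" using \<rho> by (auto intro: power_le_one)
        then have "\<rho>\<^sup>2 * e' \<le> 1 * e'" using e' by (intro mult_right_mono) auto
        then show ?thesis unfolding c_def by (simp add: algebra_simps)
      qed
      finally have "loss (X (Suc t)) (Y (Suc t)) P1 Q1 \<le> \<rho>\<^sup>2 * f\<^sup>2 + \<epsilon>" using ce' by linarith
      then show ?thesis using inv1 g1 g2 by blast
    qed
    have "(fdist (X (Suc t)) (Y (Suc t)))\<^sup>2 \<le> (\<rho> * f)\<^sup>2"
    proof (rule field_le_epsilon)
      fix \<epsilon> :: real assume "0 < \<epsilon>"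
      then obtain P1 Q1 where "minv r P1 Q1" "loss (X (Suc t)) (Y (Suc t)) P1 Q1 \<le> \<rho>\<^sup>2 * f\<^sup>2 + \<epsilon>"
        using main by blast
      then show "(fdist (X (Suc t)) (Y (Suc t)))\<^sup>2 \<le> (\<rho> * f)\<^sup>2 + \<epsilon>"
        using fdist_sq_le[of P1 Q1 "X (Suc t)" "Y (Suc t)"] by (simp add: power_mult_distrib)
    qed
    then have "fdist (X (Suc t)) (Y (Suc t)) \<le> \<rho> * f" by (rule power2_le_imp_le) (use \<rho> f0 in simp)
    also have "\<dots> \<le> \<rho> * (\<rho> ^ t * fdist (X 0) (Y 0))" using Suc \<rho> unfolding f_def by (intro mult_left_mono) auto
    finally have 1: "fdist (X (Suc t)) (Y (Suc t)) \<le> \<rho> ^ Suc t * fdist (X 0) (Y 0)" by simp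
    \<comment> \<open>With this \<epsilon> and f at most d, the loss is at most 4 \<rho>^2 d^2,
      exactly the square allowed at time t + 1.\<close>
    have "0 < 3 * (\<rho>\<^sup>2 * d\<^sup>2)" using \<rho> d0 by simp
    then obtain P1 Q1 where P1: "minv r P1 Q1" "loss (X (Suc t)) (Y (Suc t)) P1 Q1 \<le> \<rho>\<^sup>2 * f\<^sup>2 + 3 * (\<rho>\<^sup>2 * d\<^sup>2)"
       "norm (tr P1 * P1 - idm r) \<le> C * (1 - \<rho> ^ Suc t)" "norm (Q1 * tr Q1 - idm r) \<le> C * (1 - \<rho> ^ Suc t)"
      using main by blast
    have "\<rho>\<^sup>2 * f\<^sup>2 \<le> \<rho>\<^sup>2 * d\<^sup>2" using fd2 by (intro mult_left_mono) auto
    then have "loss (X (Suc t)) (Y (Suc t)) P1 Q1 \<le> 4 * (\<rho>\<^sup>2 * d\<^sup>2)" using P1(2) by linarith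
    also have "\<dots> = (2 * (\<rho> ^ Suc t * D))\<^sup>2" unfolding d_def by (simp add: power_mult_distrib)
    finally show ?case using 1 P1 by blast
  qed
  then show ?thesis by blast
qed

end

section \<open>Rank, singular values and spectral norm\<close>

text \<open>Each summand has product entries, hence rank at most 1, and rank is subadditive.\<close>

lemma rank_le_sum_products:
  fixes A :: "real mat"
  assumes "A \<in> carrier_mat n nc"
    and "\<And>i j. i < n \<Longrightarrow> j < nc \<Longrightarrow> A $$ (i, j) = (\<Sum>k<K. f k i * g k j)"
  shows "mat_rank n A \<le> K"
  using assms
proof (induction K arbitrary: A)
  case 0
  then have "A = 0\<^sub>m n nc" by (intro eq_matI) auto
  then show ?case unfolding mat_rank_def by (simp add: vec_space.rank_0I)
next
  case (Suc K)
  let ?B = "mat n nc (\<lambda>(i, j). \<Sum>k<K. f k i * g k j)" and ?C = "mat n nc (\<lambda>(i, j). f K i * g K j)"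
  have "A = ?B + ?C" using Suc.prems by (intro eq_matI) auto
  moreover have "mat_rank n ?B \<le> K" by (rule Suc.IH) auto
  moreover have "mat_rank n ?C \<le> 1"
    unfolding mat_rank_def by (rule vec_space.rank_le_1_product_entries[of _ _ nc "f K" "g K"]) auto
  moreover have "vec_space.rank n (?B + ?C) \<le> vec_space.rank n ?B + vec_space.rank n ?C"
    by (rule vec_space.rank_subadditive[of _ _ nc]) auto
  ultimately show ?case unfolding mat_rank_def by simp
qed

lemma rank_low:
  assumes "low n1 n2 r H"
  shows "mat_rank n1 (unemb n1 n2 H) \<le> r"
proof -
  obtain L R where LR: "fdim n1 r L" "fdim r n2 R" "H = L * R" using assms unfolding low_def by blast
  show ?thesis
    by (rule rank_le_sum_products[where nc = n2 and K = r and f = "\<lambda>k i. ent L i k" and g = "\<lambda>k j. ent R k j"])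
       (auto simp: unemb_def LR(3) ent_times_fdim[OF LR(1)])
qed

lemma fdim_low: "low n1 n2 r H \<Longrightarrow> fdim n1 n2 H"
  unfolding low_def by blast

text \<open>The sum of two matrices that factor through dimension r has rank at most 2r, so the RIP
  of order 2r provides exactly the hypothesis of \<open>polarized_rip\<close>.\<close>

lemma RIP_low:
  assumes rip: "RIP A m n1 n2 (2 * r) \<delta>" and dA: "\<And>i. i < m \<Longrightarrow> A i \<in> carrier_mat n1 n2"
    and low: "low n1 n2 r H1" "low n1 n2 r H2"
  shows "\<bar>(\<Sum>i<m. inner (emb (A i)) H1 * inner (emb (A i)) H2) - inner H1 H2\<bar> \<le> \<delta> * norm H1 * norm H2"
proof (rule polarized_rip[of "low n1 n2 r"])
  fix H1 H2 assume l: "low n1 n2 r H1" "low n1 n2 r H2"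
  define M where "M = unemb n1 n2 (H1 + H2)"
  have M: "M \<in> carrier_mat n1 n2" unfolding M_def by simp
  have e: "emb M = H1 + H2" unfolding M_def using l by (intro emb_unemb fdim_linear fdim_low)
  have "M = unemb n1 n2 H1 + unemb n1 n2 H2" unfolding M_def unemb_def by (intro eq_matI) auto
  then have "mat_rank n1 M \<le> mat_rank n1 (unemb n1 n2 H1) + mat_rank n1 (unemb n1 n2 H2)"
    unfolding mat_rank_def by (simp add: vec_space.rank_subadditive[of _ _ n2])
  then have "mat_rank n1 M \<le> 2 * r" using rank_low[OF l(1)] rank_low[OF l(2)] by simp
  then have "(1 - \<delta>) * (frob_norm M)\<^sup>2 \<le> (\<Sum>i<m. (mat_inner (A i) M)\<^sup>2)"
    "(\<Sum>i<m. (mat_inner (A i) M)\<^sup>2) \<le> (1 + \<delta>) * (frob_norm M)\<^sup>2"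
    using rip M unfolding RIP_def by auto
  moreover have "(\<Sum>i<m. (mat_inner (A i) M)\<^sup>2) = (\<Sum>i<m. (inner (emb (A i)) (H1 + H2))\<^sup>2)"
    using mat_inner_emb[OF dA M] e by simp
  moreover have "frob_norm M = norm (H1 + H2)" unfolding norm_emb[symmetric] e ..
  ultimately show "\<bar>(\<Sum>i<m. (inner (emb (A i)) (H1 + H2))\<^sup>2) - (norm (H1 + H2))\<^sup>2\<bar> \<le> \<delta> * (norm (H1 + H2))\<^sup>2"
    by (simp add: abs_le_iff algebra_simps)
qed (use low low_scale in auto)

section \<open>Extreme singular values of the factors\<close>

lemma norm_ent_mono:
  assumes "\<And>i j. \<bar>ent A i j\<bar> \<le> \<bar>ent B i j\<bar>"
  shows "norm A \<le> norm B"
proof -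
  obtain n where n: "bnd n A" "bnd n B" using bnd_ex3 by blast
  have "inner A A \<le> inner B B"
    unfolding inner_bnd2[OF n(1)] inner_bnd2[OF n(2)]
    by (intro sum_mono) (metis assms abs_le_square_iff power2_eq_square)
  then show ?thesis unfolding norm_eq_sqrt_inner by simp
qed

lemma norm_isometry:
  assumes "tr U * U = idm r" "idm r * B = B"
  shows "norm (U * B) = norm B"
  unfolding norm_eq_sqrt_inner inner_mult_left
  by (simp add: mult.assoc[symmetric] assms)

lemma norm_idm_1: "norm (idm 1) = 1"
  unfolding norm_eq_sqrt_inner inner_bnd2[OF bnd_idm] by (simp add: ent_idm)

lemma ent_diag_mult:
  "ent (emb (mat_diag r f) * B) i j = (if i < r then f i * ent B i j else 0)"
proof -
  have "fdim r r (emb (mat_diag r f))" by (rule fdim_emb) simp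
  then have "ent (emb (mat_diag r f) * B) i j = (\<Sum>k<r. ent (emb (mat_diag r f)) i k * ent B k j)"
    by (rule ent_times_fdim)
  also have "\<dots> = (\<Sum>k<r. if k = i then (if i < r then f i * ent B i j else 0) else 0)"
    by (intro sum.cong refl) (auto simp: ent_emb mat_diag_def)
  finally show ?thesis by simp
qed

text \<open>U has orthonormal columns and drops out of the norm; the diagonal factor is then
  compared entry by entry with a multiple of B. In the third claim \<open>idm 1\<close> plays the
  first basis vector, written as a column, at which the largest singular value is attained.\<close>

lemma svd_factor_bounds:
  assumes U: "U \<in> carrier_mat n r" "transpose_mat U * U = 1\<^sub>m r"
    and s: "\<And>i. i < r \<Longrightarrow> 0 \<le> l \<and> l \<le> f i \<and> f i \<le> u" and u0: "0 \<le> u"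
  shows "norm (emb (U * mat_diag r f) * B) \<le> u * norm B"
    and "fdim r k B \<Longrightarrow> l * norm B \<le> norm (emb (U * mat_diag r f) * B)"
    and "0 < r \<Longrightarrow> f 0 = u \<Longrightarrow> norm (emb (U * mat_diag r f) * idm 1) = u"
proof -
  let ?D = "emb (mat_diag r f)"
  have dD: "fdim r r ?D" by (rule fdim_emb) simp
  have e: "emb (U * mat_diag r f) = emb U * ?D" by (rule emb_mult[OF U(1) mat_diag_dim])
  have "tr (emb U) * emb U = idm r"
    using emb_mult[of "transpose_mat U" r n U r] U by (simp add: emb_transpose emb_one)
  then have iso: "norm (emb (U * mat_diag r f) * B) = norm (?D * B)" for B
    unfolding e mult.assoc by (rule norm_isometry) (simp add: mult.assoc[symmetric] idm_times[OF dD])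
  have "norm (?D * B) \<le> norm (u *\<^sub>R B)"
  proof (rule norm_ent_mono)
    fix i j
    show "\<bar>ent (?D * B) i j\<bar> \<le> \<bar>ent (u *\<^sub>R B) i j\<bar>"
      using s[of i] u0 unfolding ent_diag_mult by (auto simp: abs_mult intro!: mult_right_mono)
  qed
  then show "norm (emb (U * mat_diag r f) * B) \<le> u * norm B" unfolding iso using u0 by simp
  show "l * norm B \<le> norm (emb (U * mat_diag r f) * B)" if B: "fdim r k B"
  proof -
    have "norm (l *\<^sub>R B) \<le> norm (?D * B)"
    proof (rule norm_ent_mono)
      fix i j
      show "\<bar>ent (l *\<^sub>R B) i j\<bar> \<le> \<bar>ent (?D * B) i j\<bar>"
        using s[of i] fdimD[OF B, of i j] unfolding ent_diag_mult by (auto simp: abs_mult intro!: mult_right_mono)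
    qed
    moreover have "l * norm B \<le> norm (l *\<^sub>R B)" by (simp add: mult_right_mono)
    ultimately show ?thesis unfolding iso by linarith
  qed
  show "norm (emb (U * mat_diag r f) * idm 1) = u" if "0 < r" "f 0 = u"
  proof -
    have "?D * idm 1 = u *\<^sub>R idm 1"
      by (rule fmat_eqI) (use that in \<open>auto simp: ent_diag_mult ent_idm\<close>)
    then show ?thesis unfolding iso using u0 norm_idm_1 by simp
  qed
qed

section \<open>Spectral norms of the initial factors\<close>

definition colm :: "real vec \<Rightarrow> real mat" where
  "colm v = mat (dim_vec v) 1 (\<lambda>(i, j). v $ i)"

lemma norm_colm: "norm (emb (colm v)) = vec_norm2 v"
  unfolding norm_emb frob_norm_def vec_norm2_def by (simp add: colm_def)

lemma emb_colm_mult: "Y \<in> carrier_mat n r \<Longrightarrow> v \<in> carrier_vec r \<Longrightarrow> emb (colm (Y *\<^sub>v v)) = emb Y * emb (colm v)"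
proof -
  assume Y: "Y \<in> carrier_mat n r" and v: "v \<in> carrier_vec r"
  have "col (colm v) 0 = v" by (intro eq_vecI) (auto simp: colm_def)
  then have "colm (Y *\<^sub>v v) = Y * colm v" using Y v by (intro eq_matI) (auto simp: colm_def)
  then show ?thesis using emb_mult[of Y n r "colm v" 1] Y v by (simp add: colm_def)
qed

text \<open>An orthogonal R preserves the unit sphere, so the spectral norm of Y is that of Y R,
  which is a \<delta>-perturbation of \<open>Ys\<close>. This ties the step sizes, normalized by the
  initial factors, to the true value \<open>u\<close>.\<close>

lemma spec_norm_near:
  assumes Y: "Y \<in> carrier_mat n r" and R: "fdim r r R" "tr R * R = idm r" "R * tr R = idm r" and r: "0 < r"
    and near: "norm (emb Y * R - Ys) \<le> \<delta>"
    and up: "\<And>B. norm (Ys * B) \<le> u * norm B" and top: "norm (Ys * idm 1) = u"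
  shows "u - \<delta> \<le> spec_norm Y" "spec_norm Y \<le> u + \<delta>"
proof -
  let ?S = "{vec_norm2 (Y *\<^sub>v v) | v. v \<in> carrier_vec (dim_col Y) \<and> vec_norm2 v = 1}"
  have dc: "dim_col Y = r" using Y by simp
  have bound: "x \<le> u + \<delta>" if xS: "x \<in> ?S" for x
  proof -
    obtain v where v: "v \<in> carrier_vec r" "vec_norm2 v = 1" "x = vec_norm2 (Y *\<^sub>v v)" using xS unfolding dc by blast
    define c where "c = emb (colm v)"
    have dc: "fdim r 1 c" unfolding c_def using v(1) by (intro fdim_emb) (auto simp: colm_def)
    have nc: "norm c = 1" unfolding c_def norm_colm using v by simp
    have "R * (tr R * c) = c" unfolding mult.assoc[symmetric] R(3) by (rule idm_times[OF dc])
    then have eq: "emb Y * c = Ys * (tr R * c) + (emb Y * R - Ys) * (tr R * c)"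
      by (simp add: left_diff_distrib mult.assoc)
    have n1: "norm (tr R * c) = 1"
    proof -
      have "norm (R * (tr R * c)) = norm (tr R * c)"
        using idm_times[OF fdim_times[OF fdim_linear(6)[OF R(1)] dc]] by (rule norm_isometry[OF R(2)])
      then show ?thesis using \<open>R * (tr R * c) = c\<close> nc by simp
    qed
    have "x = norm (emb Y * c)" unfolding c_def emb_colm_mult[OF Y v(1), symmetric] norm_colm v(3) ..
    also have "\<dots> \<le> norm (Ys * (tr R * c)) + norm ((emb Y * R - Ys) * (tr R * c))" unfolding eq by (rule norm_triangle_ineq)
    also have "\<dots> \<le> u + \<delta>"
      using up[of "tr R * c"] norm_mult_ineq[of "emb Y * R - Ys" "tr R * c"] near n1 by simp
    finally show ?thesis .
  qed
  \<comment> \<open>For the lower bound the test vector is R applied to the first basis vector,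
    which is a top right singular vector of \<open>Ys\<close>.\<close>
  have dI: "fdim r 1 (idm 1)" using r by (auto simp: fdim_def ent_idm)
  define b where "b = R * idm 1"
  have db: "fdim r 1 b" unfolding b_def using R dI by blast
  define v where "v = col (unemb r 1 b) 0"
  have v: "v \<in> carrier_vec r" unfolding v_def unemb_def by simp
  have "colm v = unemb r 1 b" unfolding v_def by (intro eq_matI) (auto simp: colm_def unemb_def)
  then have cv: "emb (colm v) = b" using emb_unemb[OF db] by simp
  have nb: "norm b = 1" unfolding b_def norm_isometry[OF R(2) idm_times[OF dI]] by (rule norm_idm_1)
  have in_S: "vec_norm2 (Y *\<^sub>v v) \<in> ?S" using v dc norm_colm[of v] cv nb by auto
  have "vec_norm2 (Y *\<^sub>v v) = norm (emb Y * R * idm 1)"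
    unfolding norm_colm[symmetric] emb_colm_mult[OF Y v] cv b_def mult.assoc ..
  moreover have "norm (Ys * idm 1) \<le> norm (emb Y * R * idm 1) + norm ((emb Y * R - Ys) * idm 1)"
    using norm_triangle_ineq4[of "emb Y * R * idm 1" "(emb Y * R - Ys) * idm 1"] by (simp add: left_diff_distrib)
  moreover have "norm ((emb Y * R - Ys) * idm 1) \<le> \<delta>"
    using norm_mult_ineq[of "emb Y * R - Ys" "idm 1"] near norm_idm_1 by simp
  ultimately have "u - \<delta> \<le> vec_norm2 (Y *\<^sub>v v)" using top by linarith
  also have "\<dots> \<le> spec_norm Y" unfolding spec_norm_def
    using in_S bound by (intro cSup_upper bdd_aboveI) auto
  finally show "u - \<delta> \<le> spec_norm Y" .
  show "spec_norm Y \<le> u + \<delta>" unfolding spec_norm_def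
    using in_S bound by (intro cSup_least) auto
qed

section \<open>Stacked factors and the transfer of the distance\<close>

lemma frob_append_rows:
  assumes X: "X \<in> carrier_mat n1 r" "Xs \<in> carrier_mat n1 r" and Y: "Y \<in> carrier_mat n2 r" "Ys \<in> carrier_mat n2 r"
    and R: "R \<in> carrier_mat r r"
  shows "frob_norm ((X @\<^sub>r Y) * R - (Xs @\<^sub>r Ys)) = sqrt ((frob_norm (X * R - Xs))\<^sup>2 + (frob_norm (Y * R - Ys))\<^sup>2)"
proof -
  have split: "(\<Sum>i<n1 + n2. g i) = (\<Sum>i<n1. g i) + (\<Sum>i<n2. g (n1 + i))" for g :: "nat \<Rightarrow> real"
    by (induction n2) auto
  have idx: "(A @\<^sub>r B) $$ (i, j) = (if i < n1 then A $$ (i, j) else B $$ (i - n1, j))"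
    if "A \<in> carrier_mat n1 r" "B \<in> carrier_mat n2 r" "i < n1 + n2" "j < r" for A B :: "real mat" and i j
    using that unfolding append_rows_def by auto
  have row: "row (X @\<^sub>r Y) i = (if i < n1 then row X i else row Y (i - n1))" if "i < n1 + n2" for i
    using that X Y carrier_matD[OF carrier_append_rows[OF X(1) Y(1)]] by (intro eq_vecI) (auto simp: idx[OF X(1) Y(1)])
  let ?M = "(X @\<^sub>r Y) * R - (Xs @\<^sub>r Ys)"
  have dims: "dim_row ?M = n1 + n2" "dim_col ?M = r"
    using carrier_matD[OF carrier_append_rows[OF X(2) Y(2)]] by auto
  have ent: "?M $$ (i, j) = (if i < n1 then (X * R - Xs) $$ (i, j) else (Y * R - Ys) $$ (i - n1, j))"
    if "i < n1 + n2" "j < r" for i j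
    using that X Y R carrier_matD[OF carrier_append_rows[OF X(1) Y(1)]] carrier_matD[OF carrier_append_rows[OF X(2) Y(2)]]
    by (auto simp: row idx[OF X(2) Y(2)])
  have "(\<Sum>i<n1 + n2. \<Sum>j<r. (?M $$ (i, j))\<^sup>2) = (\<Sum>i<n1. \<Sum>j<r. ((X * R - Xs) $$ (i, j))\<^sup>2) + (\<Sum>i<n2. \<Sum>j<r. ((Y * R - Ys) $$ (i, j))\<^sup>2)"
    unfolding split by (intro arg_cong2[where f = "(+)"] sum.cong refl) (auto simp only: ent split: if_splits, auto simp: ent)
  then show ?thesis
    unfolding frob_norm_def dims using X Y R by (simp add: sum_nonneg)
qed

lemma minv_emb:
  assumes "P \<in> carrier_mat r r" "Q \<in> carrier_mat r r" "P * Q = 1\<^sub>m r" "Q * P = 1\<^sub>m r"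
  shows "minv r (emb P) (emb Q)"
  unfolding minv_def
  using fdim_emb[OF assms(1)] fdim_emb[OF assms(2)] emb_mult[OF assms(1,2)] emb_mult[OF assms(2,1)]
  by (simp add: assms(3,4) emb_one)

lemma unemb_minv:
  assumes "minv r P Q"
  shows "unemb r r P * unemb r r Q = 1\<^sub>m r"
proof (rule emb_inj[of _ r r])
  have "emb (unemb r r P * unemb r r Q) = emb (unemb r r P) * emb (unemb r r Q)"
    by (rule emb_mult[OF unemb_carrier unemb_carrier])
  then show "emb (unemb r r P * unemb r r Q) = emb (1\<^sub>m r)"
    using assms by (simp add: minv_def emb_unemb emb_one)
qed (use mult_carrier_mat[OF unemb_carrier unemb_carrier] in auto)

lemma (in ground_truth) fac_dist_eq:
  assumes X: "X \<in> carrier_mat n1 r" "Xs' \<in> carrier_mat n1 r" and Y: "Y \<in> carrier_mat n2 r" "Ys' \<in> carrier_mat n2 r"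
    and e: "Xs = emb Xs'" "Ys = emb Ys'"
  shows "fac_dist r X Y Xs' Ys' = fdist (emb X) (emb Y)"
proof -
  have loss: "sqrt ((frob_norm (X * P - Xs'))\<^sup>2 + (frob_norm (Y * transpose_mat Q - Ys'))\<^sup>2)
      = sqrt (loss (emb X) (emb Y) (emb P) (emb Q))"
    if P: "P \<in> carrier_mat r r" and Q: "Q \<in> carrier_mat r r" for P Q
  proof -
    have "emb (X * P - Xs') = emb X * emb P - Xs"
      unfolding e emb_mult[OF X(1) P, symmetric] using X P by (intro emb_minus) auto
    moreover have "emb (Y * transpose_mat Q - Ys') = emb Y * tr (emb Q) - Ys"
      unfolding e emb_transpose[symmetric] emb_mult[OF Y(1) transpose_carrier_mat[THEN iffD2, OF Q], symmetric]
      using Y Q by (intro emb_minus) auto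
    ultimately show ?thesis unfolding loss_def norm_emb[symmetric] by simp
  qed
  have "{sqrt ((frob_norm (X * P - Xs'))\<^sup>2 + (frob_norm (Y * transpose_mat Q - Ys'))\<^sup>2) | P Q.
      P \<in> carrier_mat r r \<and> Q \<in> carrier_mat r r \<and> P * Q = 1\<^sub>m r \<and> Q * P = 1\<^sub>m r}
    = {sqrt (loss (emb X) (emb Y) P Q) | P Q. minv r P Q}" (is "?L = ?R")
  proof (intro equalityI subsetI)
    fix x assume "x \<in> ?L"
    then show "x \<in> ?R" using loss minv_emb by blast
  next
    fix x assume "x \<in> ?R"
    then obtain P Q where PQ: "minv r P Q" "x = sqrt (loss (emb X) (emb Y) P Q)" by blast
    then have "minv r Q P" "fdim r r P" "fdim r r Q" unfolding minv_def by auto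
    then have "x = sqrt ((frob_norm (X * unemb r r P - Xs'))\<^sup>2 + (frob_norm (Y * transpose_mat (unemb r r Q) - Ys'))\<^sup>2)"
      unfolding PQ(2) by (subst loss) (auto simp: emb_unemb)
    then show "x \<in> ?L" using unemb_minv[OF PQ(1)] unemb_minv[OF \<open>minv r Q P\<close>] unemb_carrier by blast
  qed
  then show ?thesis unfolding fac_dist_def fdist_def by simp
qed

text \<open>A relative error of 1/1000 in the spectral norm roughly doubles when squared and
  inverted, still within 1/200.\<close>

lemma step_size_near:
  fixes x u :: real
  assumes u: "0 < u" and x: "u - u / 1000 \<le> x" "x \<le> u + u / 1000"
  shows "\<bar>1/1000 / x\<^sup>2 - 1/1000 / u\<^sup>2\<bar> \<le> 1/1000 / u\<^sup>2 / 200"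
proof -
  have x0: "0 < x" using u x by simp
  define q where "q = u / x"
  have "u \<le> 1000/999 * x" using x by simp
  then have "q \<le> 1000/999" unfolding q_def using x0 by (simp add: field_simps)
  moreover have "1000/1001 * x \<le> u" using x by simp
  then have "1000/1001 \<le> q" unfolding q_def using x0 by (simp add: field_simps)
  ultimately have "(1000/1001)\<^sup>2 \<le> q\<^sup>2" "q\<^sup>2 \<le> (1000/999)\<^sup>2"
    by (auto intro!: power_mono)
  then have q2: "\<bar>q\<^sup>2 - 1\<bar> \<le> 1/200" 
  proof -
    have "995/1000 \<le> (1000/1001 :: real)\<^sup>2" "(1000/999 :: real)\<^sup>2 \<le> 1005/1000"
      by (simp_all add: power2_eq_square)
    then show ?thesis
      using \<open>(1000/1001)\<^sup>2 \<le> q\<^sup>2\<close> \<open>q\<^sup>2 \<le> (1000/999)\<^sup>2\<close> by linarith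
  qed
  have "1/1000 / x\<^sup>2 - 1/1000 / u\<^sup>2 = 1/1000 / u\<^sup>2 * (q\<^sup>2 - 1)"
    unfolding q_def using u x0 by (simp add: field_simps)
  then have "\<bar>1/1000 / x\<^sup>2 - 1/1000 / u\<^sup>2\<bar> = 1/1000 / u\<^sup>2 * \<bar>q\<^sup>2 - 1\<bar>" by (simp add: abs_mult)
  also have "\<dots> \<le> 1/1000 / u\<^sup>2 * (1/200)" using q2 by (intro mult_left_mono) auto
  finally show ?thesis by simp
qed

text \<open>Carries \<open>gd_converges\<close> over to carrier matrices. What remains is to verify
  the locale assumptions from the decomposition, the recursion under the embedding, and the
  closeness of both normalized step sizes to 1/1000 / u^2.\<close>

lemma matrix_gd_converges:
  fixes A X Y :: "nat \<Rightarrow> real mat" and U V :: "real mat" and s :: "nat \<Rightarrow> real" and r :: nat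
  defines "Xs \<equiv> U * mat_diag r (\<lambda>i. sqrt (s i))" and "Ys \<equiv> V * mat_diag r (\<lambda>i. sqrt (s i))"
    and "\<kappa> \<equiv> s 0 / s (r - 1)"
  assumes r: "0 < r" and svd: "compact_svd Ms n1 n2 r U s V"
    and dA: "\<And>i. i < m \<Longrightarrow> A i \<in> carrier_mat n1 n2"
    and y: "\<And>i. i < m \<Longrightarrow> y i = mat_inner (A i) Ms"
    and rip: "RIP A m n1 n2 (2 * r) \<delta>" "\<delta> \<le> 1/200"
    and X0: "X 0 \<in> carrier_mat n1 r" and Y0: "Y 0 \<in> carrier_mat n2 r"
    and init: "Inf {frob_norm ((X 0 @\<^sub>r Y 0) * R - (Xs @\<^sub>r Ys)) | R. R \<in> orth_mats r}
          \<le> 1 / 10 ^ 9 * (1 / \<kappa> powr (3/2)) * sqrt (s (r - 1))"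
    and X: "\<And>t. X (Suc t) = X t - (1/1000 / (spec_norm (Y 0))^2) \<cdot>\<^sub>m
              msum n1 r (\<lambda>i. (mat_inner (A i) (X t * transpose_mat (Y t)) - y i) \<cdot>\<^sub>m (A i * Y t)) m"
    and Y: "\<And>t. Y (Suc t) = Y t - (1/1000 / (spec_norm (X 0))^2) \<cdot>\<^sub>m
              msum n2 r (\<lambda>i. (mat_inner (A i) (X t * transpose_mat (Y t)) - y i) \<cdot>\<^sub>m (transpose_mat (A i) * X t)) m"
  shows "fac_dist r (X t) (Y t) Xs Ys \<le> (1 - 1/1000 / (50 * \<kappa>)) ^ t * fac_dist r (X 0) (Y 0) Xs Ys"
proof -
  define u where "u = sqrt (s 0)"
  define l where "l = sqrt (s (r - 1))"
  define D where "D = (l / u) ^ 3 * l / 10 ^ 9"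
  have U: "U \<in> carrier_mat n1 r" "transpose_mat U * U = 1\<^sub>m r" and V: "V \<in> carrier_mat n2 r" "transpose_mat V * V = 1\<^sub>m r"
    and s0: "\<And>i. i < r \<Longrightarrow> 0 < s i" and smono: "\<And>i j. i \<le> j \<Longrightarrow> j < r \<Longrightarrow> s j \<le> s i"
    and Ms: "Ms = U * mat_diag r s * transpose_mat V"
    using svd unfolding compact_svd_def by auto
  have l0: "0 < l" and u0: "0 < u" unfolding l_def u_def using s0 r by auto
  have lu: "l \<le> u" unfolding l_def u_def using smono r by simp
  have sb: "0 \<le> l \<and> l \<le> sqrt (s i) \<and> sqrt (s i) \<le> u" if "i < r" for i
    unfolding l_def u_def using smono[of i "r - 1"] smono[of 0 i] that s0[of "r - 1"] r by simp
  have cXs: "Xs \<in> carrier_mat n1 r" and cYs: "Ys \<in> carrier_mat n2 r"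
    unfolding Xs_def Ys_def using U V by auto
  note bX = svd_factor_bounds[where f = "\<lambda>i. sqrt (s i)", OF U sb less_imp_le[OF u0], folded Xs_def]
  note bY = svd_factor_bounds[where f = "\<lambda>i. sqrt (s i)", OF V sb less_imp_le[OF u0], folded Ys_def]
  interpret ground_truth n1 n2 r "emb Xs" "emb Ys" u l
    by unfold_locales (use l0 lu bX(1,2) bY(1,2) fdim_emb[OF cXs] fdim_emb[OF cYs] in auto)
  have Ms': "Ms = Xs * transpose_mat Ys"
  proof -
    have dd: "mat_diag r (\<lambda>i. sqrt (s i)) * mat_diag r (\<lambda>i. sqrt (s i)) = mat_diag r s"
      unfolding mat_diag_diag by (rule eq_matI) (use s0 in \<open>auto simp: mat_diag_def less_imp_le\<close>)
    have tD: "transpose_mat (mat_diag r f) = mat_diag r f" for f :: "nat \<Rightarrow> real"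
      unfolding mat_diag_def by (intro eq_matI) auto
    have "Xs * transpose_mat Ys = U * mat_diag r (\<lambda>i. sqrt (s i)) * (mat_diag r (\<lambda>i. sqrt (s i)) * transpose_mat V)"
      unfolding Xs_def Ys_def by (subst transpose_mult[OF V(1) mat_diag_dim]) (simp add: tD)
    also have "\<dots> = U * mat_diag r (\<lambda>i. sqrt (s i)) * mat_diag r (\<lambda>i. sqrt (s i)) * transpose_mat V"
      by (rule assoc_mult_mat[OF mult_carrier_mat[OF U(1) mat_diag_dim] mat_diag_dim transpose_carrier_mat[THEN iffD2, OF V(1)], symmetric])
    also have "U * mat_diag r (\<lambda>i. sqrt (s i)) * mat_diag r (\<lambda>i. sqrt (s i)) = U * mat_diag r s"
      unfolding dd[symmetric] by (rule assoc_mult_mat[OF U(1) mat_diag_dim mat_diag_dim])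
    finally show ?thesis unfolding Ms by simp
  qed
  have dMs: "Ms \<in> carrier_mat n1 n2" unfolding Ms' using mult_carrier_mat[OF cXs transpose_carrier_mat[THEN iffD2, OF cYs]] .
  have dims: "X t \<in> carrier_mat n1 r" "Y t \<in> carrier_mat n2 r" for t
    by (induction t) (auto simp: X0 Y0 X Y msum_def)
  define a where "a = 1/1000 / (spec_norm (Y 0))\<^sup>2"
  define b where "b = 1/1000 / (spec_norm (X 0))\<^sup>2"
  define A' where "A' i = emb (A i)" for i
  have dA': "fdim n1 n2 (A' i)" if "i < m" for i unfolding A'_def by (rule fdim_emb[OF dA[OF that]])
  have res: "mat_inner (A i) (X t * transpose_mat (Y t)) - y i
      = inner (A' i) (emb (X t) * tr (emb (Y t)) - emb Xs * tr (emb Ys))" if i: "i < m" for i t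
  proof -
    have Yt: "transpose_mat (Y t) \<in> carrier_mat r n2" "transpose_mat Ys \<in> carrier_mat r n2" using dims cYs by auto
    have XY: "X t * transpose_mat (Y t) \<in> carrier_mat n1 n2" by (rule mult_carrier_mat[OF dims(1) Yt(1)])
    show ?thesis
      unfolding y[OF i] mat_inner_emb[OF dA[OF i] XY] mat_inner_emb[OF dA[OF i] dMs] A'_def inner_diff_right
      unfolding Ms' emb_mult[OF dims(1) Yt(1)] emb_mult[OF cXs Yt(2)] emb_transpose ..
  qed
  have gX: "emb (msum n1 r (\<lambda>i. (mat_inner (A i) (X t * transpose_mat (Y t)) - y i) \<cdot>\<^sub>m (A i * Y t)) m)
      = grad A' m (emb (X t)) (emb (Y t)) * emb (Y t)" for t
  proof -
    have "emb (msum n1 r (\<lambda>i. (mat_inner (A i) (X t * transpose_mat (Y t)) - y i) \<cdot>\<^sub>m (A i * Y t)) m)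
       = (\<Sum>i<m. emb ((mat_inner (A i) (X t * transpose_mat (Y t)) - y i) \<cdot>\<^sub>m (A i * Y t)))"
      by (rule emb_msum) (rule smult_carrier_mat[OF mult_carrier_mat[OF dA dims(2)]])
    also have "\<dots> = (\<Sum>i<m. (inner (A' i) (emb (X t) * tr (emb (Y t)) - emb Xs * tr (emb Ys)) *\<^sub>R A' i) * emb (Y t))"
      by (intro sum.cong refl) (simp add: res emb_smult emb_mult[OF dA dims(2)] A'_def[symmetric])
    finally show ?thesis unfolding grad_def sum_distrib_right .
  qed
  have gY: "emb (msum n2 r (\<lambda>i. (mat_inner (A i) (X t * transpose_mat (Y t)) - y i) \<cdot>\<^sub>m (transpose_mat (A i) * X t)) m)
      = tr (grad A' m (emb (X t)) (emb (Y t))) * emb (X t)" for t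
  proof -
    have tA: "transpose_mat (A i) \<in> carrier_mat n2 n1" if "i < m" for i using dA[OF that] by simp
    have tsum: "tr (\<Sum>i<k. f i) = (\<Sum>i<k. tr (f i))" for k :: nat and f by (induction k) auto
    have "emb (msum n2 r (\<lambda>i. (mat_inner (A i) (X t * transpose_mat (Y t)) - y i) \<cdot>\<^sub>m (transpose_mat (A i) * X t)) m)
       = (\<Sum>i<m. emb ((mat_inner (A i) (X t * transpose_mat (Y t)) - y i) \<cdot>\<^sub>m (transpose_mat (A i) * X t)))"
      by (rule emb_msum) (rule smult_carrier_mat[OF mult_carrier_mat[OF tA dims(1)]])
    also have "\<dots> = (\<Sum>i<m. tr (inner (A' i) (emb (X t) * tr (emb (Y t)) - emb Xs * tr (emb Ys)) *\<^sub>R A' i) * emb (X t))"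
      by (intro sum.cong refl) (simp add: res emb_smult emb_mult[OF tA dims(1)] emb_transpose A'_def[symmetric])
    finally show ?thesis unfolding grad_def tsum sum_distrib_right .
  qed
  have X': "emb (X (Suc t)) = emb (X t) - a *\<^sub>R (grad A' m (emb (X t)) (emb (Y t)) * emb (Y t))" for t
    unfolding X gX[symmetric] a_def emb_smult[symmetric]
    by (rule emb_minus[OF dims(1)]) (simp add: msum_def)
  have Y': "emb (Y (Suc t)) = emb (Y t) - b *\<^sub>R (tr (grad A' m (emb (X t)) (emb (Y t))) * emb (X t))" for t
    unfolding Y gY[symmetric] b_def emb_smult[symmetric]
    by (rule emb_minus[OF dims(2)]) (simp add: msum_def)
  have rip': "\<bar>(\<Sum>i<m. inner (A' i) H1 * inner (A' i) H2) - inner H1 H2\<bar> \<le> 1/200 * norm H1 * norm H2"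
    if "low n1 n2 r H1" "low n1 n2 r H2" for H1 H2
  proof -
    have "\<bar>(\<Sum>i<m. inner (A' i) H1 * inner (A' i) H2) - inner H1 H2\<bar> \<le> \<delta> * norm H1 * norm H2"
      unfolding A'_def by (rule RIP_low[OF rip(1) dA that])
    also have "\<dots> \<le> 1/200 * norm H1 * norm H2" using rip(2) by (intro mult_right_mono) auto
    finally show ?thesis .
  qed
  let ?S = "{frob_norm ((X 0 @\<^sub>r Y 0) * R - (Xs @\<^sub>r Ys)) | R. R \<in> orth_mats r}"
  \<comment> \<open>Hence \<kappa> to the power 3/2 is (u / l)^3, and the initialization bound is
    exactly D.\<close>
  have \<kappa>: "\<kappa> = (u / l)\<^sup>2" unfolding \<kappa>_def u_def l_def using s0 r by (simp add: power_divide less_imp_le)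
  have "\<kappa> powr (3/2) = (u / l) ^ 3"
  proof -
    have "\<kappa> powr (3/2) = ((u / l) powr 2) powr (3/2)" unfolding \<kappa> using u0 l0 by (simp add: powr_numeral)
    also have "\<dots> = (u / l) powr 3" unfolding powr_powr by simp
    finally show ?thesis using u0 l0 by (simp add: powr_numeral)
  qed
  then have init': "Inf ?S \<le> D"
    using init unfolding D_def l_def[symmetric] by (simp add: power_divide mult.commute)
  \<comment> \<open>An orthogonal R is an alignment with inverse R^T, and its inverse transpose is R
    again. The Procrustes distance therefore bounds the distance over all invertible
    matrices.\<close>
  have orth: "minv r (emb R) (tr (emb R))
      \<and> frob_norm ((X 0 @\<^sub>r Y 0) * R - (Xs @\<^sub>r Ys)) = sqrt (loss (emb (X 0)) (emb (Y 0)) (emb R) (tr (emb R)))"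
    if "R \<in> orth_mats r" for R
  proof -
    have R: "R \<in> carrier_mat r r" "transpose_mat R * R = 1\<^sub>m r" using that unfolding orth_mats_def by auto
    have tR: "transpose_mat R \<in> carrier_mat r r" using R by simp
    have "R * transpose_mat R = 1\<^sub>m r" by (rule mat_mult_left_right_inverse[OF tR R])
    then have "minv r (emb R) (tr (emb R))"
      unfolding emb_transpose[symmetric] using R tR by (intro minv_emb)
    moreover have "emb (X 0 * R - Xs) = emb (X 0) * emb R - emb Xs"
      unfolding emb_mult[OF X0 R(1), symmetric] using X0 R cXs by (intro emb_minus) auto
    moreover have "emb (Y 0 * R - Ys) = emb (Y 0) * emb R - emb Ys"
      unfolding emb_mult[OF Y0 R(1), symmetric] using Y0 R cYs by (intro emb_minus) auto
    ultimately show ?thesis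
      unfolding frob_append_rows[OF X0 cXs Y0 cYs R(1)] loss_def unfolding norm_emb[symmetric] by simp
  qed
  have one: "1\<^sub>m r \<in> orth_mats r" unfolding orth_mats_def by simp
  have D0: "0 < D" unfolding D_def using l0 u0 by simp
  have "fdist (emb (X 0)) (emb (Y 0)) \<le> Inf ?S"
    using one orth fdist_le by (intro cInf_greatest) force+
  then have start: "fdist (emb (X 0)) (emb (Y 0)) \<le> D" using init' by linarith
  \<comment> \<open>Passing from D to 2 D yields an orthogonal witness without compactness of the
    orthogonal group.\<close>
  have "Inf ?S < 2 * D" using init' D0 by linarith
  then obtain R where R: "R \<in> orth_mats r" "frob_norm ((X 0 @\<^sub>r Y 0) * R - (Xs @\<^sub>r Ys)) < 2 * D"
    using cInf_lessD[of ?S "2 * D"] one by blast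
  define R' where "R' = emb R"
  have R': "minv r R' (tr R')" "sqrt (loss (emb (X 0)) (emb (Y 0)) R' (tr R')) < 2 * D"
    using orth[OF R(1)] R(2) unfolding R'_def by auto
  have lR: "loss (emb (X 0)) (emb (Y 0)) R' (tr R') \<le> (2 * D)\<^sup>2"
    using power_mono[OF less_imp_le[OF R'(2)], of 2] loss_nonneg by simp
  have "(norm (emb (X 0) * R' - emb Xs))\<^sup>2 \<le> (2 * D)\<^sup>2" "(norm (emb (Y 0) * R' - emb Ys))\<^sup>2 \<le> (2 * D)\<^sup>2"
    using lR zero_le_power2[of "norm (emb (X 0) * R' - emb Xs)"] zero_le_power2[of "norm (emb (Y 0) * R' - emb Ys)"]
    unfolding loss_def tr_linear by linarith+
  then have near: "norm (emb (X 0) * R' - emb Xs) \<le> 2 * D" "norm (emb (Y 0) * R' - emb Ys) \<le> 2 * D"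
    using D0 by (auto intro: power2_le_imp_le)
  have Ru: "2 * D \<le> u / 1000"
  proof -
    have "(l / u) ^ 3 \<le> 1" using l0 u0 lu by (intro power_le_one) auto
    then have "(l / u) ^ 3 * l \<le> 1 * u" using l0 u0 lu by (intro mult_mono) auto
    then have "D \<le> 1 * u / 10 ^ 9" unfolding D_def by (rule divide_right_mono) simp
    then show ?thesis using u0 by simp
  qed
  have dR': "fdim r r R'" "tr R' * R' = idm r" "R' * tr R' = idm r" using R'(1) unfolding minv_def by auto
  have top: "norm (emb Xs * idm 1) = u" "norm (emb Ys * idm 1) = u"
    using bX(3) bY(3) r by (auto simp: u_def)
  have a: "\<bar>a - 1/1000 / u\<^sup>2\<bar> \<le> 1/1000 / u\<^sup>2 / 200"
    unfolding a_def
    by (rule step_size_near[OF u0]) (use spec_norm_near[OF Y0 dR' r near(2) upY top(2)] Ru in linarith)+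
  have b: "\<bar>b - 1/1000 / u\<^sup>2\<bar> \<le> 1/1000 / u\<^sup>2 / 200"
    unfolding b_def
    by (rule step_size_near[OF u0]) (use spec_norm_near[OF X0 dR' r near(1) upX top(1)] Ru in linarith)+
  have rate: "1 - 1/1000 / (50 * \<kappa>) = 1 - (l / u)\<^sup>2 / 50000" unfolding \<kappa> by (simp add: power_divide)
  show ?thesis
    unfolding rate fac_dist_eq[OF dims(1) cXs dims(2) cYs refl refl]
    by (rule gd_converges[OF rip' dA' fdim_emb[OF X0] fdim_emb[OF Y0] X' Y' a b D_def R'(1) lR start])
qed

theorem theorem1:
  shows "\<exists>c>0. \<exists>c0>0. \<exists>c1>0.
    \<forall>(n1::nat) (n2::nat) (r::nat) (m::nat) (Ms::real mat) (U::real mat) (s::nat \<Rightarrow> real) (V::real mat)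
      (A::nat \<Rightarrow> real mat) (y::nat \<Rightarrow> real) (X::nat \<Rightarrow> real mat) (Y::nat \<Rightarrow> real mat).
      let Xs = U * mat_diag r (\<lambda>i. sqrt (s i));
          Ys = V * mat_diag r (\<lambda>i. sqrt (s i));
          \<sigma>max = s 0; \<sigma>min = s (r - 1); \<kappa> = \<sigma>max / \<sigma>min;
          \<eta> = c1
      in
      (0 < r \<and> Ms \<in> carrier_mat n1 n2 \<and> mat_rank n1 Ms = r \<and>
       compact_svd Ms n1 n2 r U s V \<and>
       (\<forall>i<m. A i \<in> carrier_mat n1 n2) \<and>
       (\<forall>i<m. y i = mat_inner (A i) Ms) \<and>
       (\<exists>\<delta>. RIP A m n1 n2 (2 * r) \<delta> \<and> \<delta> \<le> c) \<and>
       X 0 \<in> carrier_mat n1 r \<and> Y 0 \<in> carrier_mat n2 r \<and>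
       Inf {frob_norm ((X 0 @\<^sub>r Y 0) * R - (Xs @\<^sub>r Ys)) | R. R \<in> orth_mats r}
          \<le> c0 * (1 / \<kappa> powr (3/2)) * sqrt \<sigma>min \<and>
       (\<forall>t. X (Suc t) = X t - (\<eta> / (spec_norm (Y 0))^2) \<cdot>\<^sub>m
              msum n1 r (\<lambda>i. (mat_inner (A i) (X t * transpose_mat (Y t)) - y i) \<cdot>\<^sub>m (A i * Y t)) m) \<and>
       (\<forall>t. Y (Suc t) = Y t - (\<eta> / (spec_norm (X 0))^2) \<cdot>\<^sub>m
              msum n2 r (\<lambda>i. (mat_inner (A i) (X t * transpose_mat (Y t)) - y i) \<cdot>\<^sub>m (transpose_mat (A i) * X t)) m))
      \<longrightarrow> (\<forall>t. fac_dist r (X t) (Y t) Xs Ys \<le> (1 - \<eta> / (50 * \<kappa>)) ^ t * fac_dist r (X 0) (Y 0) Xs Ys)"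
  \<comment> \<open>The witnesses are the RIP tolerance of \<open>one_step\<close>, the
    initialization constant for which the total Gram drift fits its tolerance, and the largest
    \<open>eta\<close> that it admits.\<close>
  apply (rule exI[of _ "1/200"], intro conjI, simp)
  apply (rule exI[of _ "1 / 10 ^ 9"], intro conjI, simp)
  apply (rule exI[of _ "1/1000"], intro conjI, simp)
  apply (unfold Let_def, intro allI impI, elim conjE exE)
  subgoal premises p for n1 n2 r m Ms U s V A y X Y t \<delta>
    by (rule matrix_gd_converges[where A = A and m = m and Ms = Ms and y = y and \<delta> = \<delta> and ?n1.0 = n1 and ?n2.0 = n2])
       (use p in blast)+
  done

end
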